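(* Let $k\ge 1$ be an integer and let $G_1, G_2,\dots, G_{2k+1}$ be pairwise vertex-disjoint 4-critical planar graphs, each with a fixed embedding in the plane. For each $1\le i\le 2k+1$, let $u^i_1u^i_2u^i_3$ be a path (on three distinct vertices) lying in the boundary of some face of $G_i$. Let $G=G_1\circ G_2\circ\cdots\circ G_{2k+1}$ be the graph obtained from the disjoint union of $G_1,\dots,G_{2k+1}$ by (a) deleting the edges $u^i_2u^i_3$ for all $1\le i\le 2k+1$; (b) identifying $u^1_1$ with $u^{2k+1}_3$, and identifying $u^i_3$ with $u^{i+1}_1$ for all $1\le i\le 2k$; (c) adding a new vertex $z$ and the $2k+1$ new edges $zu^1_2, zu^2_2,\dots, zu^{2k+1}_2$. Then $G$ is a 4-critical planar graph.
   Context: Graphs are finite and simple. A graph is $k$-colorable if its vertices can be assigned $k$ colors so that adjacent vertices get different colors; $\chi(G)$ is the least $k$ such that $G$ is $k$-colorable. A graph $G$ is 4-critical if $\chi(G)=4$ and $G-e$ is 3-colorable for every edge $e$ of $G$ (where $G-e$ denotes $G$ with the edge $e$ deleted). A planar graph is a graph that can be embedded in the plane, i.e. drawn so that edges intersect only at their endpoints. In the construction, superscripts on $u^i_j$ are indices, not powers. *)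

theory Defs
  imports "HOL-Analysis.Analysis"
begin

datatype 'a graph = Graph (verts: "'a set") (edges: "'a set set")

definition simple_graph :: "'a graph \<Rightarrow> bool" where
  "simple_graph G \<longleftrightarrow> finite (verts G) \<and> (\<forall>e\<in>edges G. e \<subseteq> verts G \<and> card e = 2)"

definition delete_edges :: "'a graph \<Rightarrow> 'a set set \<Rightarrow> 'a graph" where
  "delete_edges G D = Graph (verts G) (edges G - D)"

definition colorable :: "nat \<Rightarrow> 'a graph \<Rightarrow> bool" where
  "colorable k G \<longleftrightarrow>
     (\<exists>c :: 'a \<Rightarrow> nat. (\<forall>v\<in>verts G. c v < k) \<and> (\<forall>v w. {v, w} \<in> edges G \<longrightarrow> c v \<noteq> c w))"

definition chromatic_number :: "'a graph \<Rightarrow> nat" where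
  "chromatic_number G = (LEAST k. colorable k G)"

definition four_critical :: "'a graph \<Rightarrow> bool" where
  "four_critical G \<longleftrightarrow>
     chromatic_number G = 4 \<and> (\<forall>e\<in>edges G. colorable 3 (delete_edges G {e}))"

text \<open>An embedding places the vertex \<open>v\<close> at the point \<open>p v\<close> and draws the edge \<open>e\<close> as the
  (arbitrary continuous) arc \<open>\<gamma> e\<close>. The plane is the type of complex numbers.\<close>

definition plane_embedding ::
    "'a graph \<Rightarrow> ('a \<Rightarrow> complex) \<Rightarrow> ('a set \<Rightarrow> real \<Rightarrow> complex) \<Rightarrow> bool" where
  "plane_embedding G p \<gamma> \<longleftrightarrow>
     inj_on p (verts G) \<and>
     (\<forall>e\<in>edges G. arc (\<gamma> e) \<and> {pathstart (\<gamma> e), pathfinish (\<gamma> e)} = p ` e \<and>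
        path_image (\<gamma> e) \<inter> p ` verts G = p ` e) \<and>
     (\<forall>e\<in>edges G. \<forall>e'\<in>edges G. e \<noteq> e' \<longrightarrow>
        path_image (\<gamma> e) \<inter> path_image (\<gamma> e') \<subseteq> p ` e \<inter> p ` e')"

definition planar :: "'a graph \<Rightarrow> bool" where
  "planar G \<longleftrightarrow> (\<exists>p \<gamma>. plane_embedding G p \<gamma>)"

definition faces ::
    "'a graph \<Rightarrow> ('a \<Rightarrow> complex) \<Rightarrow> ('a set \<Rightarrow> real \<Rightarrow> complex) \<Rightarrow> complex set set" where
  "faces G p \<gamma> = components (- (p ` verts G \<union> (\<Union>e\<in>edges G. path_image (\<gamma> e))))"

text \<open>The vertices of the disjoint union are taken from one type, so it is only meaningful for
  graphs with pairwise disjoint vertex sets.\<close>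

definition union_graph :: "'i set \<Rightarrow> ('i \<Rightarrow> 'a graph) \<Rightarrow> 'a graph" where
  "union_graph I G = Graph (\<Union>i\<in>I. verts (G i)) (\<Union>i\<in>I. edges (G i))"

text \<open>Identification of vertices: the quotient by the equivalence relation generated by \<open>r\<close>.
  The new vertices are the equivalence classes.\<close>

definition identify :: "('a \<Rightarrow> 'a \<Rightarrow> bool) \<Rightarrow> 'a graph \<Rightarrow> 'a set graph" where
  "identify r G = (let cls = (\<lambda>v. {w. equivclp r v w})
                   in Graph (cls ` verts G) ((`) cls ` edges G))"

text \<open>The new vertex is \<open>None\<close>; it is joined to the vertices in \<open>N\<close>.\<close>

definition add_vertex :: "'a graph \<Rightarrow> 'a set \<Rightarrow> 'a option graph" where
  "add_vertex G N = Graph (insert None (Some ` verts G))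
     ((`) Some ` edges G \<union> (\<lambda>w. {None, Some w}) ` N)"

text \<open>\<open>glue n u\<close> relates \<open>u i 3\<close> to \<open>u (i + 1) 1\<close>, the index \<open>i\<close> running cyclically through
  \<open>1, \<dots>, n\<close>.\<close>

definition glue :: "nat \<Rightarrow> (nat \<Rightarrow> nat \<Rightarrow> 'a) \<Rightarrow> 'a \<Rightarrow> 'a \<Rightarrow> bool" where
  "glue n u x y \<longleftrightarrow> (\<exists>i\<in>{1..n}. x = u i 3 \<and> y = u (if i = n then 1 else i + 1) 1)"

definition circ_compose ::
    "nat \<Rightarrow> (nat \<Rightarrow> 'a graph) \<Rightarrow> (nat \<Rightarrow> nat \<Rightarrow> 'a) \<Rightarrow> 'a set option graph" where
  "circ_compose n G u =
     add_vertex
       (identify (glue n u)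
         (delete_edges (union_graph {1..n} G) ((\<lambda>i. {u i 2, u i 3}) ` {1..n})))
       ((\<lambda>i. {w. equivclp (glue n u) (u i 2) w}) ` {1..n})"

end

theory Submission
  imports Defs "HOL-Complex_Analysis.Riemann_Mapping"
begin

text \<open>Colouring: in a 3-colouring of \<open>G i - u i 2 u i 3\<close> the vertices \<open>u i 2\<close> and \<open>u i 3\<close> agree, as
  \<open>G i\<close> is not 3-colourable. So in a 3-colouring of the composition all glued vertices avoid the
  colour of the new vertex, and consecutive ones differ: an odd cycle would be 2-coloured. If an edge
  is deleted, one piece (or spoke) is relaxed and the alternation around the cycle can be completed.

  Planarity: vertices may be drawn as pairwise disjoint continua that do not separate the plane,
  because by the Riemann mapping theorem such a continuum can be collapsed to a point by a map of
  the plane that is injective elsewhere. In a piece, an arc through the face joins an accessible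
  interior point of \<open>u i 1 u i 2\<close> to an accessible interior point \<open>b\<close> of \<open>u i 2 u i 3\<close>. The three arcs
  that reach \<open>b\<close>, cut off at a small disc around \<open>b\<close>, fatten \<open>u i 1\<close>, \<open>u i 2\<close>, \<open>u i 3\<close> to continua touching
  the disc. The exterior of the disc is mapped into a half-strip so that the contact points lie on its edge
  in the order 1, 2, 3 (three points on a circle have this order up to reflection). The strips are put
  side by side and joined by segments, which become part of the glued vertices.\<close>

section \<open>Collapsing continua that do not separate the plane\<close>

text \<open>Edges are arbitrary arcs, so a piece cannot simply be redrawn with the path on its outer
  face; and the boundary points that an arc inside a face can reach are only known to be dense, so
  the vertices themselves may be out of reach. Fat vertices meet both obstacles: an accessible point
  inside the edge \<open>u i 1 u i 2\<close> will do, since the stretch of the edge from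
  \<open>u i 1\<close> up to it can be absorbed into that vertex. For \<open>u i 2\<close> and
  \<open>u i 3\<close> the deleted edge supplies the access: its two halves lead to
  \<open>b\<close>, and a small disc around \<open>b\<close> is free of what is left of the drawing.
  Fat drawings can moreover be carried by maps that are injective on the drawing only, and can be
  glued by taking unions. The order 1, 2, 3 matters because each \<open>u i 2\<close> must be
  reached from the centre, while the link from the last \<open>u i 3\<close> back to the first
  \<open>u i 1\<close> passes over the centre. Oddness drives the colouring; having at least three
  pieces keeps different edges from being merged by the gluing.\<close>

text \<open>With a hole in \<open>K\<close> the complement could not be mapped homeomorphically onto
  the plane minus a point.\<close>

definition nonsep_continuum :: "complex set \<Rightarrow> bool" where
  "nonsep_continuum K \<longleftrightarrow> compact K \<and> connected K \<and> K \<noteq> {} \<and> connected (- K)"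

lemma nonsep_continuum_sing: "nonsep_continuum {x}"
  unfolding nonsep_continuum_def by (simp add: connected_punctured_universe)

lemma nonsep_continuum_arc: "arc g \<Longrightarrow> nonsep_continuum (path_image g)"
  unfolding nonsep_continuum_def
  by (simp add: arc_imp_path compact_path_image connected_path_image connected_arc_complement)

text \<open>Janiszewski's theorem: connectedness of \<open>A \<inter> B\<close> prevents the two
  sets from closing up to a ring.\<close>

lemma nonsep_continuum_Un:
  assumes "nonsep_continuum A" "nonsep_continuum B" "connected (A \<inter> B)" "A \<inter> B \<noteq> {}"
  shows "nonsep_continuum (A \<union> B)"
  using assms Janiszewski_connected[of A B] connected_Un[of A B]
  unfolding nonsep_continuum_def by (auto simp: compact_imp_closed)

text \<open>No extension of \<open>f\<close> to the plane is involved: whether a compact set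
  separates the plane depends only on its homotopy type (Borsuk).\<close>

lemma nonsep_continuum_homeomorphic:
  assumes "nonsep_continuum K" "continuous_on K f" "inj_on f K"
  shows "nonsep_continuum (f ` K)"
proof -
  have "compact K" using assms by (simp add: nonsep_continuum_def)
  then have "K homeomorphic f ` K"
    using assms homeomorphic_compact by blast
  then have "connected (- K) \<longleftrightarrow> connected (- (f ` K))"
    using \<open>compact K\<close> assms(2)
    by (intro homotopy_eqv_separation homeomorphic_imp_homotopy_eqv compact_continuous_image)
  then show ?thesis
    using assms unfolding nonsep_continuum_def
    by (auto intro: compact_continuous_image connected_continuous_image)
qed

text \<open>\<open>W\<close> is the complement of \<open>K\<close> on the Riemann sphere, seen in
  the coordinate 1/z, with 0 standing for infinity. Connectedness of \<open>- K\<close> makes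
  \<open>W\<close> connected; connectedness of \<open>K\<close> excludes bounded components of
  \<open>- W\<close>, and together these give simple connectedness.\<close>

lemma inverted_complement:
  assumes K: "nonsep_continuum K" and "0 \<in> K"
  defines "W \<equiv> {w. w = 0 \<or> inverse w \<notin> K}"
  shows "open W" "simply_connected W"
proof -
  have cK: "closed K" "bounded K" and conn: "connected K" "connected (- K)"
    using K by (auto simp: nonsep_continuum_def compact_imp_closed compact_imp_bounded)
  obtain B where B: "B > 0" "\<And>z. z \<in> K \<Longrightarrow> norm z \<le> B"
    using \<open>bounded K\<close> bounded_pos by blast
  have inv_cont: "continuous_on (- {0}) (inverse :: complex \<Rightarrow> complex)"
    by (auto intro!: continuous_intros)
  have ball_sub: "ball 0 (1/B) \<subseteq> W"
  proof
    fix w :: complex assume "w \<in> ball 0 (1/B)"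
    then have "w \<noteq> 0 \<Longrightarrow> norm (inverse w) > B"
      using B by (auto simp: norm_inverse norm_divide field_simps)
    then show "w \<in> W" using B(2)[of "inverse w"] by (force simp: W_def)
  qed
  have opn: "open {w \<in> - {0}. inverse w \<in> V}" if "open V" for V :: "complex set"
    using continuous_open_preimage[OF inv_cont open_Compl[OF closed_singleton] that]
    by (simp add: vimage_def Int_def)
  have "W = ball 0 (1/B) \<union> {w \<in> - {0}. inverse w \<in> - K}"
    using ball_sub B by (auto simp: W_def)
  then show "open W"
    using opn[of "- K"] cK by auto
  have eq: "W = ball 0 (1/B) \<union> inverse ` (- K)"
  proof (rule antisym; rule subsetI)
    fix w assume w: "w \<in> W"
    show "w \<in> ball 0 (1/B) \<union> inverse ` (- K)"
    proof (cases "w = 0")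
      case False
      then have "inverse w \<in> - K" using w by (simp add: W_def)
      then have "inverse (inverse w) \<in> inverse ` (- K)" by blast
      then show ?thesis by simp
    qed (use B in simp)
  next
    fix w assume "w \<in> ball 0 (1/B) \<union> inverse ` (- K)"
    then show "w \<in> W" using ball_sub unfolding W_def by fastforce
  qed
  have "connected W"
    unfolding eq
  proof (rule connected_Un)
    show "connected (inverse ` (- K))"
      using conn \<open>0 \<in> K\<close> by (intro connected_continuous_image continuous_on_subset[OF inv_cont]) auto
    have "of_real (1/(2*B)) \<in> ball (0::complex) (1/B)"
      using B by (simp add: field_simps norm_divide norm_mult)
    moreover have "of_real (2*B) \<in> - K"
      using B(2)[of "of_real (2*B)"] B(1) by (auto simp: norm_mult)
    then have "inverse (of_real (2*B)) \<in> inverse ` (- K)" by blast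
    then have "(of_real (1/(2*B)) :: complex) \<in> inverse ` (- K)"
      by (simp add: of_real_inverse[symmetric] inverse_eq_divide)
    ultimately show "ball 0 (1/B) \<inter> inverse ` (- K) \<noteq> {}" by blast
  qed auto
  \<comment> \<open>A bounded component would lie in a compact relatively clopen part
    \<open>T\<close> of \<open>- W\<close> (Sura-Bura). Inverted, \<open>T\<close> becomes a
    nonempty clopen part of \<open>K\<close> that misses 0, against the connectedness of
    \<open>K\<close>.\<close>
  have "\<not> bounded C" if C: "C \<in> components (- W)" for C
  proof
    assume "bounded C"
    have clW: "closed (- W)" using \<open>open W\<close> by auto
    have "compact C" using closed_components[OF clW C] \<open>bounded C\<close> by (simp add: compact_eq_bounded_closed)
    then obtain T where T: "openin (top_of_set (- W)) T" "compact T" "C \<subseteq> T"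
      using Sura_Bura_clopen_subset[OF closed_imp_locally_compact[OF clW] C \<open>compact C\<close> open_UNIV]
      by (metis subset_UNIV)
    obtain V where V: "open V" "T = - W \<inter> V" using T(1) by (auto simp: openin_open)
    have T0: "T \<subseteq> - {0}" using V by (auto simp: W_def)
    have iT: "inverse ` T = K \<inter> {z \<in> - {0}. inverse z \<in> V}"
    proof (rule antisym; rule subsetI)
      fix z assume "z \<in> inverse ` T"
      then obtain w where "w \<in> T" "z = inverse w" by blast
      then show "z \<in> K \<inter> {z \<in> - {0}. inverse z \<in> V}" using V T0 by (simp add: W_def)
    next
      fix z assume z: "z \<in> K \<inter> {z \<in> - {0}. inverse z \<in> V}"
      then have "inverse z \<in> T" using V by (simp add: W_def)
      then have "inverse (inverse z) \<in> inverse ` T" by blast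
      then show "z \<in> inverse ` T" by simp
    qed
    have "openin (top_of_set K) (inverse ` T)"
      unfolding iT using opn[OF V(1)] by (auto simp: openin_open)
    moreover have "closedin (top_of_set K) (inverse ` T)"
      using T(2) T0 iT by (intro closed_subset compact_imp_closed compact_continuous_image continuous_on_subset[OF inv_cont]) auto
    ultimately have "inverse ` T = {} \<or> inverse ` T = K"
      using conn(1) connected_clopen by blast
    moreover have "T \<noteq> {}" using T(3) in_components_nonempty[OF C] by auto
    ultimately show False using iT \<open>0 \<in> K\<close> by auto
  qed
  then show "simply_connected W"
    using \<open>connected W\<close> simply_connected_eq_unbounded_complement_components[OF \<open>open W\<close>] by blast
qed

text \<open>Boundedness of \<open>Q\<close> keeps these points away from 0, the only place where
  closedness could fail. The complement will serve as a neighbourhood in the proof of continuity at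
  points of \<open>K\<close>.\<close>

lemma closed_inverse_vimage_compact:
  fixes Q :: "complex set"
  assumes "compact Q"
  shows "closed {z. z \<noteq> 0 \<and> inverse z \<in> Q}"
proof -
  obtain B where B: "B > 0" "\<And>z. z \<in> Q \<Longrightarrow> norm z \<le> B"
    using assms compact_imp_bounded bounded_pos by metis
  have "{z. z \<noteq> 0 \<and> inverse z \<in> Q} = {z \<in> {z. norm z \<ge> 1/B}. inverse z \<in> Q}"
  proof (rule antisym; rule subsetI)
    fix z :: complex assume z: "z \<in> {z. z \<noteq> 0 \<and> inverse z \<in> Q}"
    then have "inverse (norm z) \<le> B" using B(2)[of "inverse z"] by (simp add: norm_inverse)
    then show "z \<in> {z \<in> {z. norm z \<ge> 1/B}. inverse z \<in> Q}"
      using z B(1) by (simp add: field_simps)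
  next
    fix z :: complex assume "z \<in> {z \<in> {z. norm z \<ge> 1/B}. inverse z \<in> Q}"
    moreover from this have "norm z > 0" using B(1) by (auto intro: less_le_trans[of 0 "1/B"])
    ultimately show "z \<in> {z. z \<noteq> 0 \<and> inverse z \<in> Q}" by auto
  qed
  moreover have "closed {z::complex. norm z \<ge> 1/B}"
    by (intro closed_Collect_le continuous_intros)
  moreover have "continuous_on {z::complex. norm z \<ge> 1/B} inverse"
    using B by (intro continuous_intros) auto
  ultimately show ?thesis
    using continuous_closed_preimage[of "{z::complex. norm z \<ge> 1/B}" inverse Q] assms
    by (simp add: compact_imp_closed vimage_def Int_def)
qed

text \<open>The disc is turned inside out along its rays, radius r going to 1/r - 1: the unit circle
  shrinks to 0 and the centre goes to infinity. Continuity at the collapsed set will use the norm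
  formula.\<close>

lemma punctured_disc_to_plane:
  obtains \<rho> :: "complex \<Rightarrow> complex"
  where "continuous_on (ball 0 1 - {0}) \<rho>" "inj_on \<rho> (ball 0 1 - {0})"
    "\<rho> ` (ball 0 1 - {0}) = - {0}"
    "\<And>y. y \<in> ball 0 1 - {0} \<Longrightarrow> norm (\<rho> y) = 1 / norm y - 1"
proof
  define \<rho> where "\<rho> = (\<lambda>y::complex. (1 / norm y - 1) *\<^sub>R sgn y)"
  show "continuous_on (ball 0 1 - {0}) \<rho>"
    unfolding \<rho>_def sgn_div_norm by (intro continuous_intros) auto
  show nrm: "norm (\<rho> y) = 1 / norm y - 1" if "y \<in> ball 0 1 - {0}" for y
  proof -
    have "1 / norm y - 1 \<ge> 0" using that by (auto simp: field_simps)
    then show ?thesis using that unfolding \<rho>_def norm_scaleR norm_sgn by simp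
  qed
  show "inj_on \<rho> (ball 0 1 - {0})"
  proof (rule inj_onI)
    fix x y assume xy: "x \<in> ball 0 1 - {0}" "y \<in> ball 0 1 - {0}" "\<rho> x = \<rho> y"
    then have n: "norm x = norm y"
      using nrm[OF xy(1)] nrm[OF xy(2)] by (auto simp: field_simps)
    then have "sgn x = sgn y"
      using xy by (auto simp: \<rho>_def)
    then show "x = y" using n xy by (simp add: sgn_div_norm)
  qed
  show "\<rho> ` (ball 0 1 - {0}) = - {0}"
  proof (rule antisym; rule subsetI)
    fix w assume "w \<in> \<rho> ` (ball 0 1 - {0})"
    then obtain y where y: "y \<in> ball 0 1 - {0}" "w = \<rho> y" by blast
    then have "norm w > 0" using nrm[OF y(1)] by auto
    then show "w \<in> - {0}" by auto
  next
    fix w :: complex assume w: "w \<in> - {0}"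
    \<comment> \<open>Radius r = 1/(1 + t) solves 1/r - 1 = t.\<close>
    define y where "y = (1 / (1 + norm w)) *\<^sub>R sgn w"
    have ny: "norm y = 1 / (1 + norm w)" and sy: "sgn y = sgn w"
      using w by (auto simp: y_def norm_sgn sgn_scaleR)
        (simp add: abs_if add_nonneg_pos)+
    have "0 < norm y" "norm y < 1" unfolding ny using w by (auto simp: field_simps add_pos_nonneg)
    then have "y \<in> ball 0 1 - {0}" by auto
    moreover have "1 / norm y - 1 = norm w" unfolding ny by simp
    then have "\<rho> y = norm w *\<^sub>R sgn w" unfolding \<rho>_def sy by (simp only:)
    then have "\<rho> y = w" using w by (simp add: sgn_div_norm)
    ultimately show "w \<in> \<rho> ` (ball 0 1 - {0})" by force
  qed
qed

text \<open>An automorphism of the disc normalises the Riemann map so that 0, which stands for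
  infinity, goes to the centre.\<close>

lemma pointed_Riemann_map:
  assumes "open W" "simply_connected W" "W \<noteq> UNIV" "(0::complex) \<in> W"
  obtains f g :: "complex \<Rightarrow> complex" where "continuous_on W f" "continuous_on (ball 0 1) g" "f 0 = 0"
    "\<And>z. z \<in> W \<Longrightarrow> f z \<in> ball 0 1 \<and> g (f z) = z"
    "\<And>z. z \<in> ball 0 1 \<Longrightarrow> g z \<in> W \<and> f (g z) = z"
proof -
  have "W \<noteq> {}" using assms by auto
  then have "\<exists>f g. f holomorphic_on W \<and> g holomorphic_on ball 0 1 \<and>
           (\<forall>z \<in> W. f z \<in> ball 0 1 \<and> g(f z) = z) \<and>
           (\<forall>z \<in> ball 0 1. g z \<in> W \<and> f(g z) = z)"
    using iffD1[OF Riemann_mapping_theorem conjI[OF assms(1,2)]] assms(3) by blast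
  then obtain f g where "f holomorphic_on W \<and> g holomorphic_on ball 0 1 \<and>
           (\<forall>z \<in> W. f z \<in> ball 0 1 \<and> g(f z) = z) \<and>
           (\<forall>z \<in> ball 0 1. g z \<in> W \<and> f(g z) = z)"
    by (elim exE)
  then have fg: "f holomorphic_on W" "g holomorphic_on ball 0 1"
    "\<And>z. z \<in> W \<Longrightarrow> f z \<in> ball 0 1 \<and> g (f z) = z"
    "\<And>z. z \<in> ball 0 1 \<Longrightarrow> g z \<in> W \<and> f (g z) = z"
    by blast+
  obtain f' g' where m: "f' (f 0) = 0" "f' holomorphic_on ball 0 1" "f' ` ball 0 1 \<subseteq> ball 0 1"
     "g' holomorphic_on ball 0 1" "g' ` ball 0 1 \<subseteq> ball 0 1"
     "\<And>z. z \<in> ball 0 1 \<Longrightarrow> f' (g' z) = z" "\<And>z. z \<in> ball 0 1 \<Longrightarrow> g' (f' z) = z"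
    using ball_biholomorphism_exists[of "f 0"] fg(3)[OF assms(4)] by blast
  show ?thesis
  proof
    show "continuous_on W (f' \<circ> f)"
      using fg(3)
      by (intro continuous_on_compose holomorphic_on_imp_continuous_on[OF fg(1)]
          continuous_on_subset[OF holomorphic_on_imp_continuous_on[OF m(2)]]) blast
    show "continuous_on (ball 0 1) (g \<circ> g')"
      by (intro continuous_on_compose holomorphic_on_imp_continuous_on[OF m(4)]
          continuous_on_subset[OF holomorphic_on_imp_continuous_on[OF fg(2)] m(5)])
    show "(f' \<circ> f) 0 = 0" using m by simp
    show "(f' \<circ> f) z \<in> ball 0 1 \<and> (g \<circ> g') ((f' \<circ> f) z) = z" if "z \<in> W" for z
      using fg(3)[OF that] m(3,7) unfolding image_subset_iff by simp
    show "(g \<circ> g') z \<in> W \<and> (f' \<circ> f) ((g \<circ> g') z) = z" if "z \<in> ball 0 1" for z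
      using fg(4)[of "g' z"] m(5,6) that unfolding image_subset_iff by simp
  qed
qed

text \<open>\<open>\<Phi>\<close> is inversion, then the Riemann map, then the inside-out map of the
  disc; infinity passes through 0 and back to infinity. As \<open>z\<close> approaches
  \<open>K\<close> from outside, its image in the disc leaves every compact subset, so the norm
  there tends to 1 and \<open>\<Phi> z\<close> to 0.\<close>

lemma collapse_containing_0:
  assumes K: "nonsep_continuum K" and "0 \<in> K"
  shows "\<exists>\<Phi> :: complex \<Rightarrow> complex. continuous_on UNIV \<Phi> \<and> (\<forall>z\<in>K. \<Phi> z = 0) \<and>
    inj_on \<Phi> (- K) \<and> \<Phi> ` (- K) = - {0}"
proof (cases "K = {0}")
  \<comment> \<open>Here \<open>W\<close> would be the whole plane, which has no Riemann map onto
    the disc.\<close>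
  case True
  then show ?thesis by (intro exI[of _ "\<lambda>z. z"]) auto
next
  case False
  have "closed K" using K by (auto simp: nonsep_continuum_def compact_imp_closed)
  define W where "W = {w. w = 0 \<or> inverse w \<notin> K}"
  have W: "open W" "simply_connected W" using inverted_complement[OF assms] by (auto simp: W_def)
  obtain k where "k \<in> K" "k \<noteq> 0" using False \<open>0 \<in> K\<close> by blast
  then have "inverse k \<notin> W" by (simp add: W_def)
  then have "W \<noteq> UNIV" by blast
  have "0 \<in> W" by (simp add: W_def)
  obtain f g :: "complex \<Rightarrow> complex" where fg: "continuous_on W f" "continuous_on (ball 0 1) g" "f 0 = 0"
    "\<And>z. z \<in> W \<Longrightarrow> f z \<in> ball 0 1 \<and> g (f z) = z"
    "\<And>z. z \<in> ball 0 1 \<Longrightarrow> g z \<in> W \<and> f (g z) = z"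
    by (rule pointed_Riemann_map[OF W \<open>W \<noteq> UNIV\<close> \<open>0 \<in> W\<close>]) (rule that)
  obtain \<rho> :: "complex \<Rightarrow> complex" where \<rho>: "continuous_on (ball 0 1 - {0}) \<rho>" "inj_on \<rho> (ball 0 1 - {0})"
    "\<rho> ` (ball 0 1 - {0}) = - {0}"
    "\<And>y. y \<in> ball 0 1 - {0} \<Longrightarrow> norm (\<rho> y) = 1 / norm y - 1"
    by (rule punctured_disc_to_plane) (rule that)
  define \<Phi> where "\<Phi> z = (if z \<in> K then 0 else \<rho> (f (inverse z)))" for z
  have invW: "inverse z \<in> W - {0}" if "z \<notin> K" for z
    using that \<open>0 \<in> K\<close> by (auto simp: W_def)
  have f_ne: "f w \<in> ball 0 1 - {0}" if "w \<in> W - {0}" for w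
  proof -
    have "f w \<noteq> f 0" using fg(4)[of w] fg(4)[OF \<open>0 \<in> W\<close>] that by force
    then show ?thesis using fg(3) fg(4)[of w] that by auto
  qed
  have contK: "continuous_on (- K) \<Phi>"
  proof -
    have "continuous_on (- K) (\<lambda>z. \<rho> (f (inverse z)))"
    proof (rule continuous_on_compose2[OF \<rho>(1)])
      show "continuous_on (- K) (\<lambda>z. f (inverse z))"
        proof (rule continuous_on_compose2[OF fg(1)])
        show "continuous_on (- K) inverse" using \<open>0 \<in> K\<close> by (intro continuous_intros) auto
        show "inverse ` (- K) \<subseteq> W" using invW by blast
      qed
      show "(\<lambda>z. f (inverse z)) ` (- K) \<subseteq> ball 0 1 - {0}"
        by (intro image_subsetI f_ne[OF invW]) simp
    qed
    then show ?thesis by (rule continuous_on_eq) (simp add: \<Phi>_def)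
  qed
  have "isCont \<Phi> x" for x
  proof (cases "x \<in> K")
    case False
    then show ?thesis using contK \<open>closed K\<close> by (simp add: continuous_on_eq_continuous_at open_Compl)
  next
    case True
    show ?thesis unfolding isCont_def
    proof (rule tendstoI)
      fix e :: real assume "e > 0"
      \<comment> \<open>\<open>Q\<close> is the part of \<open>W\<close> that the Riemann map sends
        to radius at most 1/(1 + e), that is, where the inside-out map has norm at least
        \<open>e\<close>. It is compact, so points with inverse in \<open>Q\<close> stay away from
        \<open>x\<close>.\<close>
      define Q where "Q = g ` cball 0 (1 / (1 + e))"
      have "1 / (1 + e) < 1" using \<open>e > 0\<close> by simp
      then have sub: "cball 0 (1 / (1 + e)) \<subseteq> ball (0::complex) 1" by auto
      have "compact Q" unfolding Q_def
        using continuous_on_subset[OF fg(2) sub] by (intro compact_continuous_image) auto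
      then have cl: "closed {z. z \<noteq> 0 \<and> inverse z \<in> Q}" by (rule closed_inverse_vimage_compact)
      have QW: "Q \<subseteq> W" using sub fg(5) by (auto simp: Q_def)
      have "x \<in> - {z. z \<noteq> 0 \<and> inverse z \<in> Q}" using QW True by (auto simp: W_def)
      then have "\<forall>\<^sub>F z in at x. z \<in> - {z. z \<noteq> 0 \<and> inverse z \<in> Q}"
        using cl by (intro eventually_at_in_open') auto
      then show "\<forall>\<^sub>F z in at x. dist (\<Phi> z) (\<Phi> x) < e"
      proof eventually_elim
        case (elim z)
        show ?case
        proof (cases "z \<in> K")
          case False
          then have z: "inverse z \<in> W - {0}" by (rule invW)
          then have "inverse z \<notin> Q" using elim by auto
          then have "f (inverse z) \<notin> cball 0 (1 / (1 + e))"
            using fg(4) z unfolding Q_def by (metis DiffD1 image_eqI)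
          then have "norm (f (inverse z)) > 1 / (1 + e)" by auto
          then have "1 / norm (f (inverse z)) < 1 + e"
            using \<open>e > 0\<close> by (smt (verit) divide_less_eq mult.commute zero_less_divide_1_iff less_divide_eq)
          then show ?thesis using \<rho>(4)[OF f_ne[OF z]] False True by (simp add: \<Phi>_def)
        qed (use True \<open>e > 0\<close> in \<open>simp add: \<Phi>_def\<close>)
      qed
    qed
  qed
  then have cont: "continuous_on UNIV \<Phi>" by (simp add: continuous_at_imp_continuous_on)
  have inj: "inj_on \<Phi> (- K)"
  proof (rule inj_onI)
    fix x y assume xy: "x \<in> - K" "y \<in> - K" "\<Phi> x = \<Phi> y"
    then have "f (inverse x) = f (inverse y)"
      using \<rho>(2) f_ne invW by (simp add: \<Phi>_def inj_on_def)
    then show "x = y" using fg(4) invW xy by (metis ComplD DiffD1 inverse_inverse_eq)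
  qed
  have im: "\<Phi> ` (- K) = - {0}"
  proof (rule antisym; rule subsetI)
    fix w assume "w \<in> \<Phi> ` (- K)"
    then obtain z where "z \<notin> K" "w = \<rho> (f (inverse z))" by (auto simp: \<Phi>_def)
    then show "w \<in> - {0}" using \<rho>(3) f_ne[OF invW] by blast
  next
    fix w :: complex assume "w \<in> - {0}"
    then obtain y where y: "y \<in> ball 0 1 - {0}" "w = \<rho> y" using \<rho>(3) by blast
    have gy: "g y \<in> W" "f (g y) = y" using fg(5) y by auto
    then have "g y \<noteq> 0" using fg(3) y by auto
    then have "inverse (g y) \<notin> K" using gy by (auto simp: W_def)
    then show "w \<in> \<Phi> ` (- K)" using y gy by (force simp: \<Phi>_def image_iff)
  qed
  show ?thesis using cont inj im by (intro exI[of _ \<Phi>]) (auto simp: \<Phi>_def)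
qed

lemma collapse_nonsep_continuum:
  assumes K: "nonsep_continuum K"
  shows "\<exists>\<Phi> :: complex \<Rightarrow> complex. continuous_on UNIV \<Phi> \<and> (\<forall>z\<in>K. \<Phi> z = 0) \<and>
    inj_on \<Phi> (- K) \<and> \<Phi> ` (- K) = - {0}"
proof -
  obtain k where "k \<in> K" using K by (auto simp: nonsep_continuum_def)
  define K' where "K' = (\<lambda>z. z - k) ` K"
  have "nonsep_continuum K'"
    unfolding K'_def by (intro nonsep_continuum_homeomorphic K continuous_intros) (auto simp: inj_on_def)
  moreover have "0 \<in> K'" using \<open>k \<in> K\<close> by (auto simp: K'_def)
  ultimately have "\<exists>\<Phi> :: complex \<Rightarrow> complex. continuous_on UNIV \<Phi> \<and> (\<forall>z\<in>K'. \<Phi> z = 0) \<and>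
    inj_on \<Phi> (- K') \<and> \<Phi> ` (- K') = - {0}"
    by (rule collapse_containing_0)
  then obtain \<Phi> :: "complex \<Rightarrow> complex" where \<Phi>: "continuous_on UNIV \<Phi>" "\<forall>z\<in>K'. \<Phi> z = 0"
    "inj_on \<Phi> (- K')" "\<Phi> ` (- K') = - {0}"
    by (elim exE conjE)
  have K': "z - k \<in> K' \<longleftrightarrow> z \<in> K" for z by (auto simp: K'_def)
  have tr: "(\<lambda>z. z - k) ` (- K) = - K'"
  proof (rule antisym; rule subsetI)
    fix w assume "w \<in> - K'"
    then have "w + k \<notin> K" using K'[of "w + k"] by auto
    then show "w \<in> (\<lambda>z. z - k) ` (- K)" by (intro image_eqI[of _ _ "w + k"]) auto
  qed (use K' in auto)
  show ?thesis
  proof (intro exI[of _ "\<lambda>z. \<Phi> (z - k)"] conjI ballI)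
    show "continuous_on UNIV (\<lambda>z. \<Phi> (z - k))"
      by (intro continuous_on_compose2[OF \<Phi>(1)] continuous_intros) auto
    show "\<Phi> (z - k) = 0" if "z \<in> K" for z using that \<Phi>(2) K' by auto
    show "inj_on (\<lambda>z. \<Phi> (z - k)) (- K)"
    proof (rule inj_onI)
      fix x y assume "x \<in> - K" "y \<in> - K" "\<Phi> (x - k) = \<Phi> (y - k)"
      then have "x - k = y - k" using K' inj_onD[OF \<Phi>(3), of "x - k" "y - k"] by auto
      then show "x = y" by simp
    qed
    show "(\<lambda>z. \<Phi> (z - k)) ` (- K) = - {0}"
      using \<Phi>(4) tr by (metis image_image)
  qed
qed

section \<open>Drawings with fat vertices\<close>

text \<open>An edge may meet its fat ends in any way, and two edges may overlap inside a common fat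
  end. Asking no more of an edge than path connectedness makes the notion stable under maps that
  collapse a vertex; arcs are recovered only when all vertices are points.\<close>

definition thick_embedding ::
    "'a graph \<Rightarrow> ('a \<Rightarrow> complex set) \<Rightarrow> ('a set \<Rightarrow> complex set) \<Rightarrow> bool" where
  "thick_embedding G K A \<longleftrightarrow>
     (\<forall>v\<in>verts G. nonsep_continuum (K v)) \<and>
     (\<forall>v\<in>verts G. \<forall>w\<in>verts G. v \<noteq> w \<longrightarrow> K v \<inter> K w = {}) \<and>
     (\<forall>e\<in>edges G. path_connected (A e) \<and> (\<forall>v\<in>verts G. A e \<inter> K v \<noteq> {} \<longleftrightarrow> v \<in> e)) \<and>
     (\<forall>e\<in>edges G. \<forall>e'\<in>edges G. e \<noteq> e' \<longrightarrow> A e \<inter> A e' \<subseteq> \<Union> (K ` (e \<inter> e')))"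

lemma thick_embeddingD:
  assumes "thick_embedding G K A"
  shows "v \<in> verts G \<Longrightarrow> nonsep_continuum (K v)"
    and "v \<in> verts G \<Longrightarrow> w \<in> verts G \<Longrightarrow> v \<noteq> w \<Longrightarrow> K v \<inter> K w = {}"
    and "e \<in> edges G \<Longrightarrow> path_connected (A e)"
    and "e \<in> edges G \<Longrightarrow> v \<in> verts G \<Longrightarrow> A e \<inter> K v \<noteq> {} \<longleftrightarrow> v \<in> e"
    and "e \<in> edges G \<Longrightarrow> e' \<in> edges G \<Longrightarrow> e \<noteq> e' \<Longrightarrow> A e \<inter> A e' \<subseteq> \<Union> (K ` (e \<inter> e'))"
  using assms unfolding thick_embedding_def by simp_all

text \<open>Injectivity is asked on a set containing the drawing, because the half-plane charts used
  later have a pole elsewhere in the plane.\<close>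

lemma thick_embedding_homeomorphic:
  assumes th: "thick_embedding G K A" and f: "continuous_on X f" "inj_on f X"
    and K: "\<And>v. v \<in> verts G \<Longrightarrow> K v \<subseteq> X" and A: "\<And>e. e \<in> edges G \<Longrightarrow> A e \<subseteq> X"
    and ends: "\<And>e. e \<in> edges G \<Longrightarrow> e \<subseteq> verts G"
  shows "thick_embedding G (\<lambda>v. f ` K v) (\<lambda>e. f ` A e)"
proof -
  have Int: "f ` S \<inter> f ` T = f ` (S \<inter> T)" if "S \<subseteq> X" "T \<subseteq> X" for S T
    using inj_on_image_Int[OF f(2) that] by simp
  show ?thesis
    unfolding thick_embedding_def
  proof (intro conjI ballI impI)
    fix v assume "v \<in> verts G"
    then show "nonsep_continuum (f ` K v)"
      using K[OF \<open>v \<in> verts G\<close>]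
      by (intro nonsep_continuum_homeomorphic thick_embeddingD(1)[OF th]
          continuous_on_subset[OF f(1)] inj_on_subset[OF f(2)])
  next
    fix v w assume "v \<in> verts G" "w \<in> verts G" "v \<noteq> w"
    then show "f ` K v \<inter> f ` K w = {}"
      using thick_embeddingD(2)[OF th] K by (simp add: Int)
  next
    fix e assume e: "e \<in> edges G"
    show "path_connected (f ` A e)"
      by (intro path_connected_continuous_image thick_embeddingD(3)[OF th e]
          continuous_on_subset[OF f(1) A[OF e]])
    show "f ` A e \<inter> f ` K v \<noteq> {} \<longleftrightarrow> v \<in> e" if "v \<in> verts G" for v
      using thick_embeddingD(4)[OF th e that] unfolding Int[OF A[OF e] K[OF that]] by simp
  next
    fix e e' assume e: "e \<in> edges G" "e' \<in> edges G" "e \<noteq> e'"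
    then have "A e \<inter> A e' \<subseteq> \<Union> (K ` (e \<inter> e'))" by (rule thick_embeddingD(5)[OF th])
    then have "f ` (A e \<inter> A e') \<subseteq> f ` \<Union> (K ` (e \<inter> e'))" by (rule image_mono)
    then show "f ` A e \<inter> f ` A e' \<subseteq> (\<Union>v\<in>e \<inter> e'. f ` K v)"
      using Int[OF A A] e by (simp add: image_UN)
  qed
qed

lemma image_Int_image_nonempty: "f ` S \<inter> f ` T \<noteq> {} \<Longrightarrow> \<exists>x\<in>S. \<exists>y\<in>T. f x = f y"
  by auto

text \<open>Only points of \<open>K v0\<close> are identified. Two sets whose images newly meet
  therefore both met \<open>K v0\<close> before, so each new incidence or crossing concerns
  \<open>v0\<close> and was already allowed.\<close>

lemma thick_embedding_collapse:
  assumes th: "thick_embedding G K A" and v0: "v0 \<in> verts G"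
    and \<Phi>: "continuous_on UNIV \<Phi>" "\<forall>z\<in>K v0. \<Phi> z = 0" "inj_on \<Phi> (- K v0)" "\<Phi> ` (- K v0) = - {0}"
  shows "thick_embedding G (\<lambda>v. \<Phi> ` K v) (\<lambda>e. \<Phi> ` A e)"
proof -
  note nsc = thick_embeddingD(1)[OF th] and disj = thick_embeddingD(2)[OF th]
    and pc = thick_embeddingD(3)[OF th] and meet = thick_embeddingD(4)[OF th]
    and cross = thick_embeddingD(5)[OF th]
  have fib: "x = y \<or> x \<in> K v0 \<and> y \<in> K v0" if "\<Phi> x = \<Phi> y" for x y
  proof (cases "x \<in> K v0 \<or> y \<in> K v0")
    case True
    have "\<Phi> z = 0 \<longleftrightarrow> z \<in> K v0" for z using \<Phi>(2,4) by blast
    then show ?thesis using True that by metis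
  next
    case False
    then show ?thesis using \<Phi>(3) that by (auto dest: inj_onD)
  qed
  show ?thesis
    unfolding thick_embedding_def
  proof (intro conjI ballI impI)
    fix v assume v: "v \<in> verts G"
    show "nonsep_continuum (\<Phi> ` K v)"
    proof (cases "v = v0")
      case True
      then have "\<Phi> ` K v = {0}" using \<Phi>(2) nsc[OF v] by (auto simp: nonsep_continuum_def)
      then show ?thesis by (simp add: nonsep_continuum_sing)
    next
      case False
      then have sub: "K v \<inter> K v0 = {}" using disj v v0 by blast
      \<comment> \<open>\<open>\<Phi>\<close> is onto and merges no point of \<open>K v\<close> with
        another one, so the complement of the image is the image of a connected complement.\<close>
      have "- (\<Phi> ` K v) = \<Phi> ` (- K v)"
      proof (rule antisym; rule subsetI)
        fix w assume "w \<in> - (\<Phi> ` K v)"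
        moreover have "w \<in> range \<Phi>"
        proof (cases "w = 0")
          case True
          then show ?thesis using \<Phi>(2) nsc[OF v0] by (force simp: nonsep_continuum_def)
        qed (use \<Phi>(4) in blast)
        ultimately show "w \<in> \<Phi> ` (- K v)" by blast
      next
        fix w assume "w \<in> \<Phi> ` (- K v)"
        then show "w \<in> - (\<Phi> ` K v)" using fib sub by blast
      qed
      then show ?thesis
        using nsc[OF v] continuous_on_subset[OF \<Phi>(1)] unfolding nonsep_continuum_def
        by (auto intro!: compact_continuous_image connected_continuous_image)
    qed
  next
    fix v w assume vw: "v \<in> verts G" "w \<in> verts G" "v \<noteq> w"
    show "\<Phi> ` K v \<inter> \<Phi> ` K w = {}"
    proof (rule ccontr)
      assume "\<Phi> ` K v \<inter> \<Phi> ` K w \<noteq> {}"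
      then obtain x y where "x \<in> K v" "y \<in> K w" "\<Phi> x = \<Phi> y" using image_Int_image_nonempty by meson
      moreover from this have "x \<noteq> y" using disj[OF vw] by blast
      ultimately have "v = v0" "w = v0" using fib[of x y] disj v0 vw by blast+
      then show False using vw by blast
    qed
  next
    fix e assume e: "e \<in> edges G"
    show "path_connected (\<Phi> ` A e)"
      using pc[OF e] continuous_on_subset[OF \<Phi>(1)] by (auto intro: path_connected_continuous_image)
    show "\<Phi> ` A e \<inter> \<Phi> ` K v \<noteq> {} \<longleftrightarrow> v \<in> e" if v: "v \<in> verts G" for v
    proof
      assume "\<Phi> ` A e \<inter> \<Phi> ` K v \<noteq> {}"
      then obtain x y where xy: "x \<in> A e" "y \<in> K v" "\<Phi> x = \<Phi> y" using image_Int_image_nonempty by meson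
      show "v \<in> e"
      proof (cases "x = y")
        case True
        then show ?thesis using xy meet[OF e v] by blast
      next
        case False
        then have "x \<in> K v0" "y \<in> K v0" using fib xy by blast+
        then have "v = v0" using disj v v0 xy by blast
        then show ?thesis using meet[OF e v0] xy \<open>x \<in> K v0\<close> by blast
      qed
    next
      assume "v \<in> e"
      then show "\<Phi> ` A e \<inter> \<Phi> ` K v \<noteq> {}" using meet[OF e v] by blast
    qed
  next
    fix e e' assume e: "e \<in> edges G" "e' \<in> edges G" "e \<noteq> e'"
    show "\<Phi> ` A e \<inter> \<Phi> ` A e' \<subseteq> (\<Union>v\<in>e \<inter> e'. \<Phi> ` K v)"
    proof
      fix w assume "w \<in> \<Phi> ` A e \<inter> \<Phi> ` A e'"
      then obtain x y where xy: "x \<in> A e" "y \<in> A e'" "w = \<Phi> x" "w = \<Phi> y" by blast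
      show "w \<in> (\<Union>v\<in>e \<inter> e'. \<Phi> ` K v)"
      proof (cases "x = y")
        case True
        then show ?thesis using xy cross[OF e] by blast
      next
        case False
        then have k: "x \<in> K v0" "y \<in> K v0" using fib xy by metis+
        then have "v0 \<in> e \<inter> e'" using meet[OF _ v0] e xy by blast
        then show ?thesis using xy k by blast
      qed
    qed
  qed
qed

text \<open>One collapse per vertex; a later collapse distorts the other vertices but takes points
  to points.\<close>

lemma thick_embedding_singletons:
  assumes "thick_embedding G K A" "finite S" "S \<subseteq> verts G"
  shows "\<exists>K' A'. thick_embedding G K' A' \<and> (\<forall>v\<in>S. \<exists>x. K' v = {x})"
  using assms(2,3)
proof (induction rule: finite_induct)
  case empty
  then show ?case using assms(1) by blast
next
  case (insert v0 S)
  then obtain K' A' where th: "thick_embedding G K' A'" and sing: "\<forall>v\<in>S. \<exists>x. K' v = {x}" by blast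
  have v0: "v0 \<in> verts G" using insert.prems by simp
  have n: "nonsep_continuum (K' v0)" by (rule thick_embeddingD(1)[OF th v0])
  obtain \<Phi> :: "complex \<Rightarrow> complex" where \<Phi>: "continuous_on UNIV \<Phi>" "\<forall>z\<in>K' v0. \<Phi> z = 0"
      "inj_on \<Phi> (- K' v0)" "\<Phi> ` (- K' v0) = - {0}"
    using collapse_nonsep_continuum[OF n] by (elim exE conjE)
  have "thick_embedding G (\<lambda>v. \<Phi> ` K' v) (\<lambda>e. \<Phi> ` A' e)"
    by (rule thick_embedding_collapse[OF th v0 \<Phi>])
  moreover have "\<Phi> ` K' v0 = {0}" using \<Phi>(2) n by (auto simp: nonsep_continuum_def)
  moreover have "\<exists>x. \<Phi> ` K' v = {x}" if "v \<in> S" for v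
    using sing that by (metis image_empty image_insert)
  ultimately show ?case by blast
qed

text \<open>Once the vertices are points, each path connected edge set contains an arc between its
  two ends, and passing to smaller sets adds no crossings.\<close>

theorem thick_embedding_imp_planar:
  assumes G: "simple_graph G" and th: "thick_embedding G K A"
  shows "planar G"
proof -
  obtain K' A' where th': "thick_embedding G K' A'" and "\<forall>v\<in>verts G. \<exists>x. K' v = {x}"
    using thick_embedding_singletons[OF th, of "verts G"] G by (auto simp: simple_graph_def)
  then obtain p where p: "\<And>v. v \<in> verts G \<Longrightarrow> K' v = {p v}" by metis
  note pc = thick_embeddingD(3)[OF th'] and cross = thick_embeddingD(5)[OF th']
  have meet: "p v \<in> A' e \<longleftrightarrow> v \<in> e" if "e \<in> edges G" "v \<in> verts G" for e v
    using thick_embeddingD(4)[OF th' that] p[OF that(2)] by simp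
  have inj: "inj_on p (verts G)"
  proof (rule inj_onI)
    fix v w assume vw: "v \<in> verts G" "w \<in> verts G" "p v = p w"
    then have "K' v \<inter> K' w \<noteq> {}" using p by simp
    then show "v = w" using vw thick_embeddingD(2)[OF th'] by blast
  qed
  have "\<exists>g. arc g \<and> path_image g \<subseteq> A' e \<and> {pathstart g, pathfinish g} = p ` e" if e: "e \<in> edges G" for e
  proof -
    have sub: "e \<subseteq> verts G" and "card e = 2" using G e by (auto simp: simple_graph_def)
    then obtain v w where vw: "e = {v, w}" "v \<noteq> w" by (auto simp: card_2_iff)
    then have "p v \<noteq> p w" "p v \<in> A' e" "p w \<in> A' e"
      using sub meet[OF e] inj by (auto dest: inj_onD)
    then obtain g where "arc g" "path_image g \<subseteq> A' e" "pathstart g = p v" "pathfinish g = p w"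
      using pc[OF e] unfolding path_connected_arcwise by blast
    then show ?thesis using vw by auto
  qed
  then obtain \<gamma> where \<gamma>: "\<And>e. e \<in> edges G \<Longrightarrow> arc (\<gamma> e) \<and> path_image (\<gamma> e) \<subseteq> A' e
      \<and> {pathstart (\<gamma> e), pathfinish (\<gamma> e)} = p ` e"
    by metis
  have ends: "p ` e \<subseteq> path_image (\<gamma> e)" if "e \<in> edges G" for e
    using \<gamma>[OF that] pathstart_in_path_image pathfinish_in_path_image by (metis empty_subsetI insert_subset)
  have "plane_embedding G p \<gamma>"
    unfolding plane_embedding_def
  proof (intro conjI ballI impI inj)
    fix e assume e: "e \<in> edges G"
    then have sub: "e \<subseteq> verts G" using G by (auto simp: simple_graph_def)
    show "arc (\<gamma> e)" "{pathstart (\<gamma> e), pathfinish (\<gamma> e)} = p ` e" using \<gamma>[OF e] by auto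
    show "path_image (\<gamma> e) \<inter> p ` verts G = p ` e"
      using \<gamma>[OF e] meet[OF e] ends[OF e] sub by blast
    fix e' assume e': "e' \<in> edges G" "e \<noteq> e'"
    have "K' ` (e \<inter> e') = (\<lambda>v. {p v}) ` (e \<inter> e')" using p sub by (intro image_cong) auto
    then have "A' e \<inter> A' e' \<subseteq> p ` (e \<inter> e')" using cross[OF e e'] by auto
    then show "path_image (\<gamma> e) \<inter> path_image (\<gamma> e') \<subseteq> p ` e \<inter> p ` e'"
      using \<gamma>[OF e] \<gamma>[OF e'(1)] by blast
  qed
  then show ?thesis by (auto simp: planar_def)
qed

section \<open>Mapping the exterior of a disc to a half-plane\<close>

text \<open>The piece goes to the lower half-plane with its contact points \<open>D\<close> on the
  real line, so the open upper half-plane stays free for everything that is attached.\<close>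

definition half_plane_chart :: "complex set \<Rightarrow> complex set \<Rightarrow> (complex \<Rightarrow> complex) \<Rightarrow> bool" where
  "half_plane_chart X D f \<longleftrightarrow> continuous_on X f \<and> inj_on f X \<and>
     (\<forall>z\<in>X. Im (f z) \<le> 0 \<and> (Im (f z) = 0 \<longleftrightarrow> z \<in> D))"

text \<open>This Cayley-type map has its pole at \<open>s\<close> and takes the circle around
  \<open>b\<close> through \<open>s\<close> to the real line. The numerator is minus the power of
  \<open>z\<close> with respect to that circle, so the exterior goes below the line.\<close>

lemma Im_Cayley_exterior:
  fixes b s z :: complex
  assumes "z \<noteq> s"
  shows "Im (\<i> * (2 * (s - b) / (s - z) - 1)) = ((norm (s - b))\<^sup>2 - (norm (z - b))\<^sup>2) / (norm (s - z))\<^sup>2"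
proof -
  have "norm (s - z) \<noteq> 0" using assms by simp
  have "Im (\<i> * (2 * q - 1)) = 2 * Re q - 1" for q
    by simp
  from this[of "(s - b) / (s - z)"]
  have "Im (\<i> * (2 * (s - b) / (s - z) - 1)) = 2 * Re ((s - b) / (s - z)) - 1"
    by (simp only: times_divide_eq_right)
  also have "Re ((s - b) / (s - z)) = Re ((s - b) * cnj (s - z)) / (norm (s - z))\<^sup>2"
    by (simp add: complex_div_cnj[of "s - b" "s - z"])
  finally have "Im (\<i> * (2 * (s - b) / (s - z) - 1)) =
      (2 * Re ((s - b) * cnj (s - z)) - (norm (s - z))\<^sup>2) / (norm (s - z))\<^sup>2"
    using \<open>norm (s - z) \<noteq> 0\<close> by (simp add: diff_divide_distrib)
  also have "2 * Re ((s - b) * cnj (s - z)) - (norm (s - z))\<^sup>2 = (norm (s - b))\<^sup>2 - (norm (z - b))\<^sup>2"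
    unfolding cmod_power2 by (simp add: algebra_simps power2_eq_square)
  finally show ?thesis .
qed

lemma half_plane_chart_exterior:
  assumes "X \<inter> cball b r = D" "finite D" "D \<subseteq> sphere b r" "r > 0"
  shows "\<exists>f. half_plane_chart X D f"
proof -
  have "infinite (sphere b r)"
  proof
    assume "finite (sphere b r)"
    then have "sphere b r = {} \<or> (\<exists>a. sphere b r = {a})"
      using connected_finite_iff_sing[OF connected_sphere[of b r]] by simp
    moreover have "b + r \<in> sphere b r" "b - r \<in> sphere b r" using \<open>r > 0\<close> by (auto simp: dist_norm)
    ultimately have "b + r = b - r" by (metis empty_iff singletonD)
    then show False using \<open>r > 0\<close> by simp
  qed
  \<comment> \<open>The pole is a point of the circle off the finite set \<open>D\<close>, hence off
    \<open>X\<close>.\<close>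
  then obtain s where s: "s \<in> sphere b r" "s \<notin> D"
    using assms(2) by (meson finite_subset subsetI)
  have sX: "s \<notin> X" using s assms(1) by auto
  define f where "f z = \<i> * (2 * (s - b) / (s - z) - 1)" for z
  have "s \<noteq> b" using s \<open>r > 0\<close> by auto
  have "half_plane_chart X D f"
    unfolding half_plane_chart_def
  proof (intro conjI ballI)
    show "continuous_on X f" unfolding f_def using sX by (intro continuous_intros) auto
    show "inj_on f X"
    proof (rule inj_onI)
      fix x y assume xy: "x \<in> X" "y \<in> X" "f x = f y"
      then have "s - x \<noteq> 0" "s - y \<noteq> 0" using sX by auto
      moreover have "(s - b) / (s - x) = (s - b) / (s - y)" using xy(3) by (simp add: f_def)
      ultimately show "x = y" using \<open>s \<noteq> b\<close> by (simp add: frac_eq_eq)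
    qed
    fix z assume z: "z \<in> X"
    then have "z \<noteq> s" using sX by auto
    have im: "Im (f z) = (r\<^sup>2 - (norm (z - b))\<^sup>2) / (norm (s - z))\<^sup>2"
      using Im_Cayley_exterior[OF \<open>z \<noteq> s\<close>, of b] s by (simp add: f_def dist_norm norm_minus_commute)
    have pos: "(norm (s - z))\<^sup>2 > 0" using \<open>z \<noteq> s\<close> by simp
    have out: "norm (z - b) > r \<or> z \<in> D"
      using z assms(1) by (auto simp: dist_norm norm_minus_commute)
    have on: "norm (z - b) = r" if "z \<in> D"
      using that assms(3) by (auto simp: dist_norm norm_minus_commute)
    have le: "r \<le> norm (z - b)" using out on by auto
    then have "r\<^sup>2 \<le> (norm (z - b))\<^sup>2" using \<open>r > 0\<close> by simp
    then show "Im (f z) \<le> 0" using pos unfolding im by (simp add: divide_nonpos_pos)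
    have "Im (f z) = 0 \<longleftrightarrow> r\<^sup>2 = (norm (z - b))\<^sup>2" using pos unfolding im by simp
    also have "\<dots> \<longleftrightarrow> r = norm (z - b)" using \<open>r > 0\<close> by simp
    also have "\<dots> \<longleftrightarrow> z \<in> D" using out on by auto
    finally show "Im (f z) = 0 \<longleftrightarrow> z \<in> D" .
  qed
  then show ?thesis by blast
qed

text \<open>A real Moebius map of determinant 1 preserves the half-plane and its boundary; moving
  the pole to \<open>m\<close> shifts the order of the contact points cyclically.\<close>

lemma half_plane_chart_Moebius:
  fixes m :: real
  assumes f: "half_plane_chart X D f" and m: "\<And>d. d \<in> D \<Longrightarrow> f d \<noteq> m"
  shows "half_plane_chart X D (\<lambda>z. - 1 / (f z - m))"
proof -
  have ne: "f z - m \<noteq> 0" if "z \<in> X" for z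
    using f m that unfolding half_plane_chart_def by (metis Im_complex_of_real eq_iff_diff_eq_0)
  have im: "Im (- 1 / w) = Im w / (norm w)\<^sup>2" for w
    by (simp add: Im_divide cmod_power2)
  show ?thesis
    unfolding half_plane_chart_def
  proof (intro conjI ballI)
    show "continuous_on X (\<lambda>z. - 1 / (f z - m))"
      using f ne unfolding half_plane_chart_def by (intro continuous_intros) auto
    show "inj_on (\<lambda>z. - 1 / (f z - m)) X"
    proof (rule inj_onI)
      fix x y assume xy: "x \<in> X" "y \<in> X" "- 1 / (f x - m) = - 1 / (f y - m)"
      then have "f x = f y" using ne by (simp add: divide_simps)
      then show "x = y" using f xy unfolding half_plane_chart_def by (meson inj_onD)
    qed
    fix z assume z: "z \<in> X"
    have pos: "(norm (f z - m))\<^sup>2 > 0" using ne[OF z] by simp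
    show "Im (- 1 / (f z - m)) \<le> 0"
      using f z pos unfolding im half_plane_chart_def by (simp add: divide_nonpos_pos)
    show "Im (- 1 / (f z - m)) = 0 \<longleftrightarrow> z \<in> D"
      using f z pos unfolding im half_plane_chart_def by simp
  qed
qed

lemma half_plane_chart_ordered:
  assumes X: "X \<inter> cball b r = {d1, d2, d3}" and D: "{d1, d2, d3} \<subseteq> sphere b r" and "r > 0"
    and dist: "d1 \<noteq> d2" "d2 \<noteq> d3" "d1 \<noteq> d3"
  shows "\<exists>f. half_plane_chart X {d1, d2, d3} f \<and> Re (f d1) < Re (f d2) \<and> Re (f d2) < Re (f d3) \<and>
     (\<forall>z\<in>X. \<bar>Re (f z)\<bar> < 1)"
proof -
  let ?D = "{d1, d2, d3}"
  have DX: "d1 \<in> X" "d2 \<in> X" "d3 \<in> X" using X by auto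
  have real: "f d = Re (f d)" if "half_plane_chart X ?D f" "d \<in> ?D" for f d
    using that DX by (intro complex_eqI) (auto simp: half_plane_chart_def)
  have Re_ne: "Re (f d) \<noteq> Re (f d')" if "half_plane_chart X ?D f" "d \<in> ?D" "d' \<in> ?D" "d \<noteq> d'" for f d d'
  proof
    assume "Re (f d) = Re (f d')"
    then have "f d = f d'" using real[OF that(1,2)] real[OF that(1,3)] by simp
    moreover have "d \<in> X" "d' \<in> X" using that DX by auto
    ultimately show False using that(1,4) by (auto simp: half_plane_chart_def dest: inj_onD)
  qed
  obtain f0 where f0: "half_plane_chart X ?D f0"
    using half_plane_chart_exterior[OF X _ D \<open>r > 0\<close>] by auto
  define between where "between f \<longleftrightarrow> Re (f d1) < Re (f d2) \<and> Re (f d2) < Re (f d3) \<or>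
      Re (f d3) < Re (f d2) \<and> Re (f d2) < Re (f d1)" for f :: "complex \<Rightarrow> complex"
  have "\<exists>f. half_plane_chart X ?D f \<and> between f"
  proof (cases "between f0")
    case False
    define x1 x2 x3 where x: "x1 = Re (f0 d1)" "x2 = Re (f0 d2)" "x3 = Re (f0 d3)"
    have ne: "x1 \<noteq> x2" "x2 \<noteq> x3" "x1 \<noteq> x3" using Re_ne[OF f0] dist x by auto
    have out: "x2 < x1 \<and> x2 < x3 \<or> x1 < x2 \<and> x3 < x2"
      using False ne unfolding between_def x[symmetric] by auto
    \<comment> \<open>\<open>x2\<close> lies outside the interval between \<open>x1\<close> and
      \<open>x3\<close>. With the pole at their midpoint these two go to opposite values of size
      1/|h|, and \<open>x2\<close>, being farther from the pole, goes between them.\<close>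
    define m where "m = (x1 + x3) / 2"
    have fd: "f0 d1 = x1" "f0 d2 = x2" "f0 d3 = x3" using real[OF f0] x by auto
    have mne: "x1 \<noteq> m" "x2 \<noteq> m" "x3 \<noteq> m" using ne out by (auto simp: m_def field_simps)
    define f where "f z = - 1 / (f0 z - m)" for z
    have "half_plane_chart X ?D f"
      unfolding f_def using fd mne by (intro half_plane_chart_Moebius[OF f0]) auto
    moreover have "Re (f d1) = - 1 / (x1 - m)" "Re (f d2) = - 1 / (x2 - m)" "Re (f d3) = - 1 / (x3 - m)"
      unfolding f_def fd of_real_diff[symmetric] by (simp_all add: Re_divide_of_real)
    moreover define h where "h = (x3 - x1) / 2"
    have h: "x1 - m = - h" "x3 - m = h" "h \<noteq> 0" using ne by (auto simp: m_def h_def field_simps)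
    have big: "\<bar>x2 - m\<bar> > \<bar>h\<bar>" using out by (auto simp: m_def h_def abs_if field_simps)
    then have "1 / \<bar>x2 - m\<bar> < 1 / \<bar>h\<bar>" using h(3) by (simp add: frac_less2)
    then have small: "\<bar>1 / (x2 - m)\<bar> < \<bar>1 / h\<bar>" by (simp only: abs_divide abs_one)
    ultimately have "Re (f d1) = 1 / h" "Re (f d2) = - (1 / (x2 - m))" "Re (f d3) = - (1 / h)"
      using h by simp_all
    then have "between f" unfolding between_def using small by linarith
    then show ?thesis using \<open>half_plane_chart X ?D f\<close> by blast
  qed (use f0 in blast)
  then obtain f1 where f1: "half_plane_chart X ?D f1" "between f1" by blast
  \<comment> \<open>Reflection in the imaginary axis turns the order 3, 2, 1 into 1, 2, 3.\<close>
  define refl where "refl w = - cnj w" for w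
  have "half_plane_chart X ?D (\<lambda>z. refl (f1 z))"
    using f1(1) unfolding half_plane_chart_def refl_def
    by (auto intro!: continuous_intros simp: inj_on_def)
  then have "\<exists>f. half_plane_chart X ?D f \<and> Re (f d1) < Re (f d2) \<and> Re (f d2) < Re (f d3)"
    using f1 by (cases "Re (f1 d1) < Re (f1 d2)") (auto simp: between_def refl_def)
  then obtain f2 where f2: "half_plane_chart X ?D f2" "Re (f2 d1) < Re (f2 d2)" "Re (f2 d2) < Re (f2 d3)"
    by blast
  \<comment> \<open>This increasing map of the line into (-1, 1) squeezes the half-plane into a
    half-strip of width 2 and leaves imaginary parts alone.\<close>
  define \<sigma> where "\<sigma> x = x / (1 + \<bar>x\<bar>)" for x :: real
  have \<sigma>_mono: "\<sigma> x < \<sigma> y" if "x < y" for x y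
  proof -
    have "1 + \<bar>x\<bar> > 0" "1 + \<bar>y\<bar> > 0" by auto
    moreover have "x * (1 + \<bar>y\<bar>) < y * (1 + \<bar>x\<bar>)"
    proof -
      have "x * \<bar>y\<bar> \<le> y * \<bar>x\<bar>"
      proof (cases "y \<ge> 0")
        case True
        then show ?thesis using mult_left_mono[of x "\<bar>x\<bar>" y] by (simp add: mult.commute)
      qed (use that in simp)
      then show ?thesis using that by (simp add: distrib_left)
    qed
    ultimately show ?thesis by (simp add: \<sigma>_def divide_simps)
  qed
  have \<sigma>_bd: "\<bar>\<sigma> x\<bar> < 1" for x by (simp add: \<sigma>_def abs_if divide_simps)
  have \<sigma>_inj: "\<sigma> x = \<sigma> y \<longleftrightarrow> x = y" for x y using \<sigma>_mono by (metis linorder_neqE less_irrefl)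
  define f where "f z = Complex (\<sigma> (Re (f2 z))) (Im (f2 z))" for z
  have "continuous_on X f2" using f2 by (simp add: half_plane_chart_def)
  then have "continuous_on X f"
    unfolding f_def Complex_eq \<sigma>_def by (intro continuous_intros) auto
  moreover have "inj_on f X"
  proof (rule inj_onI)
    fix x y assume "x \<in> X" "y \<in> X" "f x = f y"
    moreover from this have "f2 x = f2 y" by (simp add: f_def \<sigma>_inj complex_eq_iff)
    ultimately show "x = y" using f2(1) by (auto simp: half_plane_chart_def dest: inj_onD)
  qed
  ultimately have "half_plane_chart X ?D f"
    using f2(1) by (simp add: half_plane_chart_def f_def)
  then show ?thesis using f2 \<sigma>_mono \<sigma>_bd by (intro exI[of _ f]) (auto simp: f_def)
qed

section \<open>Cutting arcs\<close>

text \<open>The part of \<open>g\<close> before its first contact with the disc. The frontier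
  argument yields a path there, and an arc with the same ends is extracted from its image.\<close>

lemma arc_truncate_at_ball:
  fixes g :: "real \<Rightarrow> complex"
  assumes "arc g" "pathstart g \<notin> cball b r" "pathfinish g = b" "r > 0"
  shows "\<exists>h. arc h \<and> path_image h \<subseteq> path_image g \<and> pathstart h = pathstart g \<and>
     pathfinish h \<in> sphere b r \<and> path_image h \<inter> cball b r = {pathfinish h}"
proof -
  have "pathstart g \<in> closure (- cball b r)" using assms closure_subset by blast
  moreover have "pathfinish g \<notin> - cball b r" using assms by simp
  ultimately obtain h where h: "path h" "pathstart h = pathstart g" "path_image h \<subseteq> path_image g"
      "path_image h - {pathfinish h} \<subseteq> interior (- cball b r)" "pathfinish h \<in> frontier (- cball b r)"
    using exists_path_subpath_to_frontier[OF arc_imp_path[OF assms(1)], of "- cball b r"] by metis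
  have fin: "pathfinish h \<in> sphere b r" using h(5) by (simp add: frontier_complement)
  then have ne: "pathstart h \<noteq> pathfinish h" using h(2) assms(2) by auto
  obtain k where k: "arc k" "path_image k \<subseteq> path_image h" "pathstart k = pathstart h" "pathfinish k = pathfinish h"
    using path_contains_arc[OF h(1) refl refl ne] by metis
  have "pathfinish h \<in> path_image k" using k(4) pathfinish_in_path_image by metis
  then have "path_image k \<inter> cball b r = {pathfinish k}"
    using k h(4) fin by (auto simp: interior_open open_Compl)
  then show ?thesis using k h fin by (intro exI[of _ k]) auto
qed

text \<open>An embedding fixes only the set of ends of an edge, not its direction; hence both halves
  are oriented from their end of the edge towards \<open>a\<close>.\<close>

lemma arc_split_at:
  fixes g :: "real \<Rightarrow> complex"
  assumes g: "arc g" and ends: "{pathstart g, pathfinish g} = {x, y}" and a: "a \<in> path_image g - {x, y}"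
  shows "\<exists>h k. arc h \<and> arc k \<and> pathstart h = x \<and> pathfinish h = a \<and> pathstart k = y \<and> pathfinish k = a \<and>
    path_image h \<subseteq> path_image g \<and> path_image k \<subseteq> path_image g \<and> path_image h \<inter> path_image k = {a}"
proof -
  have *: "\<exists>h k. arc h \<and> arc k \<and> pathstart h = pathstart g \<and> pathfinish h = a \<and>
      pathstart k = pathfinish g \<and> pathfinish k = a \<and>
      path_image h \<subseteq> path_image g \<and> path_image k \<subseteq> path_image g \<and> path_image h \<inter> path_image k = {a}"
  proof -
    have "a \<noteq> pathstart g" "a \<noteq> pathfinish g" using a ends by auto
    moreover obtain t where t: "t \<in> {0..1}" "a = g t" using a by (auto simp: path_image_def)
    ultimately have t01: "t \<noteq> 0" "t \<noteq> 1" by (auto simp: pathstart_def pathfinish_def)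
    have "path_image (subpath 0 t g) = g ` {0..t}" "path_image (subpath 1 t g) = g ` {t..1}"
      using t by (auto simp: path_image_subpath_gen closed_segment_eq_real_ivl)
    moreover have "g ` {0..t} \<inter> g ` {t..1} = {a}"
    proof -
      have inj: "inj_on g {0..1}" using g by (simp add: arc_def)
      have "g ` {0..t} \<inter> g ` {t..1} = g ` ({0..t} \<inter> {t..1})"
        using inj_on_image_Int[OF inj, of "{0..t}" "{t..1}"] t by auto
      also have "{0..t} \<inter> {t..1} = {t}" using t by auto
      finally show ?thesis using t by simp
    qed
    moreover have "g ` {0..t} \<subseteq> path_image g" "g ` {t..1} \<subseteq> path_image g"
      using t by (auto simp: path_image_def)
    moreover have "arc (subpath 0 t g)" "arc (subpath 1 t g)"
      using g t t01 by (auto intro: arc_subpath_arc)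
    ultimately show ?thesis
      using t by (intro exI[of _ "subpath 0 t g"] exI[of _ "subpath 1 t g"])
        (simp add: pathstart_def pathfinish_def subpath_def)
  qed
  show ?thesis
  proof (cases "pathstart g = x")
    case True
    then have "pathfinish g = y" using ends arc_distinct_ends[OF g] by (auto simp: doubleton_eq_iff)
    then show ?thesis using * True by simp
  next
    case False
    then have "pathfinish g = x" "pathstart g = y" using ends by (auto simp: doubleton_eq_iff)
    then show ?thesis using * by (metis Int_commute)
  qed
qed

section \<open>Fat drawings of a single piece\<close>

lemma plane_embeddingD:
  assumes "plane_embedding G p \<gamma>"
  shows "inj_on p (verts G)"
    and "e \<in> edges G \<Longrightarrow> arc (\<gamma> e)"
    and "e \<in> edges G \<Longrightarrow> {pathstart (\<gamma> e), pathfinish (\<gamma> e)} = p ` e"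
    and "e \<in> edges G \<Longrightarrow> path_image (\<gamma> e) \<inter> p ` verts G = p ` e"
    and "e \<in> edges G \<Longrightarrow> e' \<in> edges G \<Longrightarrow> e \<noteq> e' \<Longrightarrow> path_image (\<gamma> e) \<inter> path_image (\<gamma> e') \<subseteq> p ` e \<inter> p ` e'"
  using assms unfolding plane_embedding_def by simp_all

lemma finite_edges: "simple_graph G \<Longrightarrow> finite (edges G)"
  unfolding simple_graph_def by (meson Pow_iff finite_Pow_iff finite_subset subsetI)

lemma closed_drawing:
  assumes "simple_graph G" "plane_embedding G p \<gamma>" "E \<subseteq> edges G"
  shows "closed (p ` verts G \<union> (\<Union>e\<in>E. path_image (\<gamma> e)))"
proof (intro closed_Un closed_UN)
  show "closed (p ` verts G)"
    using assms(1) by (auto simp: simple_graph_def intro: finite_imp_closed)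
  show "finite E" using finite_edges[OF assms(1)] assms(3) finite_subset by blast
  show "\<forall>e\<in>E. closed (path_image (\<gamma> e))"
    using plane_embeddingD(2)[OF assms(2)] assms(3) by (auto intro: closed_path_image arc_imp_path)
qed

text \<open>The theorem on accessible boundary points asks for relatively open parts of the
  frontier. Removing the vertices and the finitely many other edges, a closed set, leaves exactly
  the open edge.\<close>

lemma face_boundary_edge_openin:
  assumes G: "simple_graph G" and emb: "plane_embedding G p \<gamma>" and F: "F \<in> faces G p \<gamma>"
    and e: "e \<in> edges G" and sub: "path_image (\<gamma> e) \<subseteq> frontier F"
  shows "openin (top_of_set (frontier F)) (path_image (\<gamma> e) - p ` e)"
proof -
  let ?X = "p ` verts G \<union> (\<Union>e\<in>edges G. path_image (\<gamma> e))"
  let ?R = "p ` verts G \<union> (\<Union>e'\<in>edges G - {e}. path_image (\<gamma> e'))"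
  have F: "F \<in> components (- ?X)" using F by (simp add: faces_def)
  have "frontier F \<subseteq> frontier (- ?X)" by (rule frontier_of_components_subset[OF F])
  also have "\<dots> \<subseteq> ?X"
    using closed_drawing[OF G emb subset_refl] by (metis frontier_complement frontier_subset_closed)
  finally have fr: "frontier F \<subseteq> ?X" .
  have "path_image (\<gamma> e) - p ` e = frontier F \<inter> - ?R"
  proof (rule antisym; rule subsetI)
    fix x assume x: "x \<in> path_image (\<gamma> e) - p ` e"
    have "x \<notin> p ` verts G" using plane_embeddingD(4)[OF emb e] x by blast
    moreover have "x \<notin> path_image (\<gamma> e')" if "e' \<in> edges G - {e}" for e'
      using plane_embeddingD(5)[OF emb e, of e'] that x by blast
    ultimately show "x \<in> frontier F \<inter> - ?R" using sub x by blast
  next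
    fix x assume x: "x \<in> frontier F \<inter> - ?R"
    then have "x \<in> path_image (\<gamma> e)" using fr by blast
    moreover have "p ` e \<subseteq> p ` verts G" using plane_embeddingD(4)[OF emb e] by blast
    ultimately show "x \<in> path_image (\<gamma> e) - p ` e" using x by blast
  qed
  moreover have "open (- ?R)"
    by (intro open_Compl closed_drawing[OF G emb]) blast
  ultimately show ?thesis by (auto simp: openin_open)
qed

lemma arc_interior_nonempty:
  assumes "arc g"
  shows "path_image g - {pathstart g, pathfinish g} \<noteq> {}"
proof -
  have "g (1/2) \<noteq> g 0" "g (1/2) \<noteq> g 1"
    using assms unfolding arc_def by (auto dest: inj_onD)
  moreover have "g (1/2) \<in> path_image g" by (auto simp: path_image_def)
  ultimately show ?thesis by (auto simp: pathstart_def pathfinish_def)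
qed

text \<open>The fat \<open>u1\<close> is the part of the edge \<open>{u1, u2}\<close> from
  \<open>u1\<close> to \<open>a\<close> followed by an arc through \<open>F\<close> towards
  \<open>b\<close>; the fat \<open>u2\<close> and \<open>u3\<close> are the two halves of the
  deleted edge. All three stop at the disc around \<open>b\<close>, in \<open>d1\<close>,
  \<open>d2\<close>, \<open>d3\<close>.\<close>

lemma thick_embedding_face_path:
  assumes G: "simple_graph G" and emb: "plane_embedding G p \<gamma>" and dist: "distinct [u1, u2, u3]"
    and e12: "{u1, u2} \<in> edges G" and e23: "{u2, u3} \<in> edges G"
    and F: "F \<in> faces G p \<gamma>" and fr12: "path_image (\<gamma> {u1, u2}) \<subseteq> frontier F"
    and fr23: "path_image (\<gamma> {u2, u3}) \<subseteq> frontier F"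
  defines "H \<equiv> delete_edges G {{u2, u3}}"
  shows "\<exists>K b r d1 d2 d3. thick_embedding H K (\<lambda>e. path_image (\<gamma> e)) \<and>
     r > 0 \<and> d1 \<in> K u1 \<and> d2 \<in> K u2 \<and> d3 \<in> K u3 \<and> {d1, d2, d3} \<subseteq> sphere b r \<and>
     (\<Union> (K ` verts H) \<union> (\<Union>e\<in>edges H. path_image (\<gamma> e))) \<inter> cball b r = {d1, d2, d3}"
proof -
  note inj = plane_embeddingD(1)[OF emb] and arc = plane_embeddingD(2)[OF emb]
    and ends = plane_embeddingD(3)[OF emb] and onv = plane_embeddingD(4)[OF emb]
    and cross = plane_embeddingD(5)[OF emb]
  let ?g12 = "path_image (\<gamma> {u1, u2})" and ?g23 = "path_image (\<gamma> {u2, u3})"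
  let ?X = "p ` verts G \<union> (\<Union>e\<in>edges G. path_image (\<gamma> e))"
  have ne: "u1 \<noteq> u2" "u2 \<noteq> u3" "u1 \<noteq> u3" "{u1, u2} \<noteq> {u2, u3}"
    using dist by (auto simp: doubleton_eq_iff)
  have sub: "e \<subseteq> verts G" if "e \<in> edges G" for e using G that by (auto simp: simple_graph_def)
  have uV: "u1 \<in> verts G" "u2 \<in> verts G" "u3 \<in> verts G" using sub[OF e12] sub[OF e23] by auto
  have p_ne: "p u1 \<noteq> p u2" "p u2 \<noteq> p u3" "p u1 \<noteq> p u3" using inj uV ne by (auto dest: inj_onD)
  have FX: "F \<inter> ?X = {}" using F in_components_subset unfolding faces_def by blast
  have "open F" "connected F"
    using F closed_drawing[OF G emb subset_refl] unfolding faces_def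
    by (auto intro: open_components in_components_connected)
  let ?V12 = "?g12 - p ` {u1, u2}" and ?V23 = "?g23 - p ` {u2, u3}"
  have V12: "?V12 \<noteq> {}" using arc_interior_nonempty[OF arc[OF e12]] ends[OF e12] by simp
  have V23: "?V23 \<noteq> {}" using arc_interior_nonempty[OF arc[OF e23]] ends[OF e23] by simp
  have g1223: "?g12 \<inter> ?g23 \<subseteq> {p u2}" using cross[OF e12 e23 ne(4)] p_ne by auto
  then have "?V12 \<inter> ?V23 = {}" by auto
  then have "?V12 \<noteq> ?V23" using V12 by auto
  \<comment> \<open>Accessible points are dense in the frontier, so an arc through \<open>F\<close>
    can join the two open edges.\<close>
  then obtain g where g: "arc g" "pathstart g \<in> ?V12" "pathfinish g \<in> ?V23" "g ` {0<..<1} \<subseteq> F"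
    using dense_accessible_frontier_point_pairs[OF \<open>open F\<close> \<open>connected F\<close>
        face_boundary_edge_openin[OF G emb F e12 fr12] face_boundary_edge_openin[OF G emb F e23 fr23] V12 V23]
    by metis
  define a where "a = pathstart g"
  define b where "b = pathfinish g"
  have a: "a \<in> ?V12" and b: "b \<in> ?V23" using g by (auto simp: a_def b_def)
  have g_im: "path_image g \<subseteq> F \<union> {a, b}"
  proof
    fix x assume "x \<in> path_image g"
    then obtain t where "t \<in> {0..1}" "x = g t" by (auto simp: path_image_def)
    then consider "x = a" | "x = b" | "t \<in> {0<..<1}" "x = g t"
      by (cases "t = 0"; cases "t = 1") (auto simp: a_def b_def pathstart_def pathfinish_def)
    then show "x \<in> F \<union> {a, b}" using g(4) by cases blast+
  qed
  \<comment> \<open>\<open>?R\<close> is what remains of the drawing without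
    \<open>{u2, u3}\<close>. It is closed and misses \<open>b\<close>, hence misses a whole disc
    around \<open>b\<close>.\<close>
  let ?R = "p ` verts G \<union> (\<Union>e\<in>edges G - {{u2, u3}}. path_image (\<gamma> e))"
  have "b \<notin> ?R"
  proof -
    have "b \<notin> p ` verts G" using onv[OF e23] b by blast
    moreover have "b \<notin> path_image (\<gamma> e)" if "e \<in> edges G - {{u2, u3}}" for e
      using cross[OF e23, of e] that b by blast
    ultimately show ?thesis by blast
  qed
  have "open (- ?R)" by (intro open_Compl closed_drawing[OF G emb]) blast
  moreover have "b \<in> - ?R" using \<open>b \<notin> ?R\<close> by (simp only: Compl_iff not_False_eq_True)
  ultimately have "\<exists>r>0. cball b r \<subseteq> - ?R"
    using open_contains_cball[of "- ?R"] by (meson bspec)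
  then obtain r where "r > 0" "cball b r \<subseteq> - ?R" by (elim exE conjE)
  then have r: "r > 0" "cball b r \<inter> ?R = {}" by blast+
  have g12R: "?g12 \<subseteq> ?R" using e12 ne(4) by blast
  have pR: "p v \<notin> cball b r" if "v \<in> verts G" for v using r(2) that by blast

  \<comment> \<open>This half must avoid \<open>p u2\<close>: it becomes part of the fat
    \<open>u1\<close>, which has to stay disjoint from the fat \<open>u2\<close>.\<close>
  obtain h12 where h12: "arc h12" "pathstart h12 = p u1" "pathfinish h12 = a"
      "path_image h12 \<subseteq> ?g12 - {p u2}"
  proof -
    obtain h k where hk: "arc h" "pathstart h = p u1" "pathfinish h = a" "path_image h \<subseteq> ?g12"
       "pathstart k = p u2" "path_image h \<inter> path_image k = {a}"
      using arc_split_at[OF arc[OF e12], of "p u1" "p u2" a] ends[OF e12] a by auto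
    have "p u2 \<in> path_image k" using hk(5) pathstart_in_path_image by metis
    then have "p u2 \<notin> path_image h" using hk(6) a by auto
    then show ?thesis using hk that by auto
  qed
  obtain h2 h3 where h: "arc h2" "arc h3" "pathstart h2 = p u2" "pathfinish h2 = b"
      "pathstart h3 = p u3" "pathfinish h3 = b" "path_image h2 \<subseteq> ?g23" "path_image h3 \<subseteq> ?g23"
      "path_image h2 \<inter> path_image h3 = {b}"
    using arc_split_at[OF arc[OF e23], of "p u2" "p u3" b] ends[OF e23] b by auto
  have out: "pathstart g \<notin> cball b r" using a g12R r(2) unfolding a_def by blast
  obtain t1 where t1: "arc t1" "path_image t1 \<subseteq> path_image g" "pathstart t1 = a"
      "pathfinish t1 \<in> sphere b r" "path_image t1 \<inter> cball b r = {pathfinish t1}"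
    using arc_truncate_at_ball[OF g(1) out b_def[symmetric] r(1)] unfolding a_def[symmetric]
    by (elim exE conjE)
  obtain t2 where t2: "arc t2" "path_image t2 \<subseteq> path_image h2" "pathstart t2 = p u2"
      "pathfinish t2 \<in> sphere b r" "path_image t2 \<inter> cball b r = {pathfinish t2}"
    using arc_truncate_at_ball[OF h(1) pR[OF uV(2), folded h(3)] h(4) r(1)] unfolding h(3)
    by (elim exE conjE)
  obtain t3 where t3: "arc t3" "path_image t3 \<subseteq> path_image h3" "pathstart t3 = p u3"
      "pathfinish t3 \<in> sphere b r" "path_image t3 \<inter> cball b r = {pathfinish t3}"
    using arc_truncate_at_ball[OF h(2) pR[OF uV(3), folded h(5)] h(6) r(1)] unfolding h(5)
    by (elim exE conjE)
  \<comment> \<open>Truncation removes the centre \<open>b\<close>, the only common point of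
    \<open>h2\<close> and \<open>h3\<close> and the only point of \<open>g\<close> on the deleted
    edge.\<close>
  have off: "b \<notin> S" if "q \<in> sphere b r" "S \<inter> cball b r = {q}" for S q
  proof
    assume "b \<in> S"
    then have "b \<in> S \<inter> cball b r" using r(1) by simp
    then show False using that r(1) by simp
  qed
  note b_off = off[OF t1(4,5)] off[OF t2(4,5)] off[OF t3(4,5)]
  have t1F: "path_image t1 \<subseteq> F \<union> {a}" using t1(2) g_im b_off(1) by auto
  have t23: "path_image t2 \<inter> path_image t3 = {}" using Int_mono[OF t2(2) t3(2)] b_off(2) unfolding h(9) by auto
  have start: "p u1 \<in> path_image h12" "a \<in> path_image h12" "a \<in> path_image t1"
      "p u2 \<in> path_image t2" "p u3 \<in> path_image t3"
    using pathstart_in_path_image[of h12] pathfinish_in_path_image[of h12] pathstart_in_path_image[of t1]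
      pathstart_in_path_image[of t2] pathstart_in_path_image[of t3] h12(2,3) t1(3) t2(3) t3(3) by simp_all
  have t2g: "path_image t2 \<subseteq> ?g23 - {p u3}" and t3g: "path_image t3 \<subseteq> ?g23 - {p u2}"
    using t2(2) t3(2) h(7,8) t23 start(4,5) by auto
  define K where "K v = (if v = u1 then path_image h12 \<union> path_image t1
     else if v = u2 then path_image t2 else if v = u3 then path_image t3 else {p v})" for v
  have K: "K u1 = path_image h12 \<union> path_image t1" "K u2 = path_image t2" "K u3 = path_image t3"
    "\<And>v. v \<noteq> u1 \<Longrightarrow> v \<noteq> u2 \<Longrightarrow> v \<noteq> u3 \<Longrightarrow> K v = {p v}"
    using ne by (auto simp: K_def)
  have pK: "p v \<in> K v" for v using start by (auto simp: K_def)
  have K1: "K u1 \<subseteq> F \<union> (?g12 - {p u2})" using K(1) h12(4) t1F a by auto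
  have onv': "u \<in> e" if "e \<in> edges G" "u \<in> verts G" "p u \<in> path_image (\<gamma> e)" for e u
  proof -
    have "p u \<in> p ` e" using onv[OF that(1)] that by blast
    then show ?thesis using inj that sub by (metis inj_on_image_mem_iff)
  qed
  have gF: "path_image (\<gamma> e) \<inter> F = {}" if "e \<in> edges G" for e using FX that by blast
  have pF: "p v \<notin> F" if "v \<in> verts G" for v using FX that by blast
  have disj: "K v \<inter> K w = {}" if v: "v \<in> verts G" and w: "w \<in> verts G" and "v \<noteq> w" for v w
  proof -
    have 12: "K u1 \<inter> K u2 = {}" and 13: "K u1 \<inter> K u3 = {}"
      using K1 K(2,3) t2g t3g g1223 gF[OF e23] by blast+
    have 1: "p v \<notin> K u1" if "v \<in> verts G" "v \<noteq> u1" "v \<noteq> u2" for v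
      using K1 pF[OF that(1)] onv'[OF e12 that(1)] that by blast
    have 2: "p v \<notin> K u2 \<union> K u3" if "v \<in> verts G" "v \<noteq> u2" "v \<noteq> u3" for v
      using K(2,3) t2g t3g onv'[OF e23 that(1)] that by blast
    have o: "p v \<noteq> p w" using inj v w \<open>v \<noteq> w\<close> by (auto dest: inj_onD)
    show ?thesis
      using 12 13 t23 1[OF v] 1[OF w] 2[OF v] 2[OF w] o K(2,3) K(4)[of v] K(4)[of w] \<open>v \<noteq> w\<close>
      by (cases "v = u1"; cases "v = u2"; cases "v = u3"; cases "w = u1"; cases "w = u2"; cases "w = u3") auto
  qed
  have VH: "verts H = verts G" and EH: "e \<in> edges H \<longleftrightarrow> e \<in> edges G \<and> e \<noteq> {u2, u3}" for e
    by (auto simp: H_def delete_edges_def)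
  \<comment> \<open>The edges keep their full arcs. That of \<open>{u1, u2}\<close> overlaps the fat
    \<open>u1\<close>, as an edge may do at its end; apart from this, edges meet the fattened
    vertices at most in the old points \<open>p v\<close>.\<close>
  have th: "thick_embedding H K (\<lambda>e. path_image (\<gamma> e))"
    unfolding thick_embedding_def VH
  proof (intro conjI ballI impI)
    fix v assume "v \<in> verts G"
    show "nonsep_continuum (K v)"
    proof (cases "v = u1")
      case True
      \<comment> \<open>Apart from \<open>a\<close> the arc \<open>t1\<close> runs inside the face,
        so the union of the two arcs does not separate.\<close>
      have "path_image h12 \<inter> path_image t1 = {a}"
        using h12(4) t1F gF[OF e12] start by blast
      then show ?thesis
        using nonsep_continuum_Un nonsep_continuum_arc h12(1) t1(1) K(1) True by simp
    next
      case False
      then show ?thesis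
        using nonsep_continuum_arc nonsep_continuum_sing t2(1) t3(1) by (simp add: K_def)
    qed
  next
    fix v w assume "v \<in> verts G" "w \<in> verts G" "v \<noteq> w"
    then show "K v \<inter> K w = {}" by (rule disj)
  next
    fix e assume "e \<in> edges H"
    then have e: "e \<in> edges G" "e \<noteq> {u2, u3}" using EH by auto
    show "path_connected (path_image (\<gamma> e))"
      using arc[OF e(1)] by (simp add: arc_imp_path path_connected_path_image)
    fix v assume v: "v \<in> verts G"
    show "path_image (\<gamma> e) \<inter> K v \<noteq> {} \<longleftrightarrow> v \<in> e"
    proof
      assume "v \<in> e"
      then show "path_image (\<gamma> e) \<inter> K v \<noteq> {}" using pK[of v] onv[OF e(1)] by blast
    next
      assume "path_image (\<gamma> e) \<inter> K v \<noteq> {}"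
      then obtain x where x: "x \<in> path_image (\<gamma> e)" "x \<in> K v" by blast
      consider "v = u1" | "v = u2" | "v = u3" | "v \<noteq> u1" "v \<noteq> u2" "v \<noteq> u3" by blast
      then show "v \<in> e"
      proof cases
        case 1
        then have x12: "x \<in> ?g12" "x \<noteq> p u2" using x K1 gF[OF e(1)] by blast+
        show ?thesis
        proof (cases "e = {u1, u2}")
          case False
          then have "x = p u1" using cross[OF e(1) e12] x12 x(1) by blast
          then show ?thesis using onv'[OF e(1) v] x(1) 1 by simp
        qed (use 1 in simp)
      next
        case 2
        then have "x \<in> ?g23" "x \<noteq> p u3" using x K(2) t2g by blast+
        then have "x = p u2" using cross[OF e(1) e23 e(2)] x(1) by blast
        then show ?thesis using onv'[OF e(1) v] x(1) 2 by simp
      next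
        case 3
        then have "x \<in> ?g23" "x \<noteq> p u2" using x K(3) t3g by blast+
        then have "x = p u3" using cross[OF e(1) e23 e(2)] x(1) by blast
        then show ?thesis using onv'[OF e(1) v] x(1) 3 by simp
      next
        case 4
        then show ?thesis using onv'[OF e(1) v] x K(4) by simp
      qed
    qed
  next
    fix e e' assume "e \<in> edges H" "e' \<in> edges H" and ee': "e \<noteq> e'"
    then have e: "e \<in> edges G" "e' \<in> edges G" using EH by auto
    have "p ` e \<inter> p ` e' = p ` (e \<inter> e')"
      using inj_on_image_Int[OF inj sub[OF e(1)] sub[OF e(2)]] by simp
    then have "path_image (\<gamma> e) \<inter> path_image (\<gamma> e') \<subseteq> p ` (e \<inter> e')"
      using cross[OF e ee'] by simp
    also have "p ` (e \<inter> e') \<subseteq> \<Union> (K ` (e \<inter> e'))"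
      by (rule image_subsetI, rule UN_I, assumption, rule pK)
    finally show "path_image (\<gamma> e) \<inter> path_image (\<gamma> e') \<subseteq> \<Union> (K ` (e \<inter> e'))" .
  qed
  define d1 d2 d3 where d: "d1 = pathfinish t1" "d2 = pathfinish t2" "d3 = pathfinish t3"
  have dK: "d1 \<in> K u1" "d2 \<in> K u2" "d3 \<in> K u3"
    unfolding d K(1-3) by (simp_all add: pathfinish_in_path_image)
  have "(\<Union> (K ` verts H) \<union> (\<Union>e\<in>edges H. path_image (\<gamma> e))) \<inter> cball b r = {d1, d2, d3}"
  proof (rule antisym)
    have "K v \<inter> cball b r \<subseteq> {d1, d2, d3}" if "v \<in> verts G" for v
    proof -
      have "path_image h12 \<inter> cball b r = {}" using h12(4) g12R r(2) by blast
      then show ?thesis using t1(5) t2(5) t3(5) pR[OF that] unfolding K_def d by auto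
    qed
    moreover have "path_image (\<gamma> e) \<inter> cball b r = {}" if "e \<in> edges H" for e
    proof -
      have "e \<in> edges G - {{u2, u3}}" using EH[of e] that by simp
      then have "path_image (\<gamma> e) \<subseteq> ?R" by (intro le_supI2 UN_upper)
      then show ?thesis using r(2) by blast
    qed
    ultimately show "(\<Union> (K ` verts H) \<union> (\<Union>e\<in>edges H. path_image (\<gamma> e))) \<inter> cball b r \<subseteq> {d1, d2, d3}"
      unfolding VH by blast
    have "{d1, d2, d3} \<subseteq> cball b r" using t1(4) t2(4) t3(4) by (auto simp: d)
    then show "{d1, d2, d3} \<subseteq> (\<Union> (K ` verts H) \<union> (\<Union>e\<in>edges H. path_image (\<gamma> e))) \<inter> cball b r"
      unfolding VH using UN_I[of u1 _ d1 K] UN_I[of u2 _ d2 K] UN_I[of u3 _ d3 K] dK uV by simp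
  qed
  then show ?thesis
    using th r(1) dK t1(4) t2(4) t3(4)
    by (intro exI[of _ K] exI[of _ b] exI[of _ r] exI[of _ d1] exI[of _ d2] exI[of _ d3]) (simp add: d)
qed

text \<open>Normal form of a piece: it is accessible from the upper half-plane at three real points,
  in the order of the path.\<close>

lemma thick_embedding_strip:
  assumes G: "simple_graph G" and emb: "plane_embedding G p \<gamma>" and dist: "distinct [u1, u2, u3]"
    and e12: "{u1, u2} \<in> edges G" and e23: "{u2, u3} \<in> edges G"
    and F: "F \<in> faces G p \<gamma>" and fr12: "path_image (\<gamma> {u1, u2}) \<subseteq> frontier F"
    and fr23: "path_image (\<gamma> {u2, u3}) \<subseteq> frontier F"
  defines "H \<equiv> delete_edges G {{u2, u3}}"
  shows "\<exists>K A x1 x2 x3. thick_embedding H K A \<and> x1 < x2 \<and> x2 < x3 \<and>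
     complex_of_real x1 \<in> K u1 \<and> complex_of_real x2 \<in> K u2 \<and> complex_of_real x3 \<in> K u3 \<and>
     (\<forall>z \<in> \<Union> (K ` verts H) \<union> \<Union> (A ` edges H). \<bar>Re z\<bar> < 1 \<and> Im z \<le> 0 \<and>
        (Im z = 0 \<longrightarrow> z \<in> {complex_of_real x1, complex_of_real x2, complex_of_real x3}))"
proof -
  obtain K b r d1 d2 d3 where th: "thick_embedding H K (\<lambda>e. path_image (\<gamma> e))" and "r > 0"
    and d: "d1 \<in> K u1" "d2 \<in> K u2" "d3 \<in> K u3" and sph: "{d1, d2, d3} \<subseteq> sphere b r"
    and X: "(\<Union> (K ` verts H) \<union> (\<Union>e\<in>edges H. path_image (\<gamma> e))) \<inter> cball b r = {d1, d2, d3}"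
    using thick_embedding_face_path[OF G emb dist e12 e23 F fr12 fr23] unfolding H_def by auto
  let ?X = "\<Union> (K ` verts H) \<union> (\<Union>e\<in>edges H. path_image (\<gamma> e))"
  have sub: "e \<subseteq> verts G" if "e \<in> edges G" for e using G that by (auto simp: simple_graph_def)
  then have uV: "u1 \<in> verts H" "u2 \<in> verts H" "u3 \<in> verts H" using e12 e23 by (auto simp: H_def delete_edges_def)
  have "d1 \<noteq> d2" "d2 \<noteq> d3" "d1 \<noteq> d3"
    using thick_embeddingD(2)[OF th uV(1,2)] thick_embeddingD(2)[OF th uV(2,3)]
      thick_embeddingD(2)[OF th uV(1,3)] d dist by auto
  then obtain f where f: "half_plane_chart ?X {d1, d2, d3} f" "Re (f d1) < Re (f d2)" "Re (f d2) < Re (f d3)"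
     "\<forall>z\<in>?X. \<bar>Re (f z)\<bar> < 1"
    using half_plane_chart_ordered[OF X sph \<open>r > 0\<close>] by auto
  have chart: "continuous_on ?X f" "inj_on f ?X" "\<And>z. z \<in> ?X \<Longrightarrow> Im (f z) \<le> 0"
      "\<And>z. z \<in> ?X \<Longrightarrow> Im (f z) = 0 \<longleftrightarrow> z \<in> {d1, d2, d3}"
    using f(1) unfolding half_plane_chart_def by simp_all
  have "thick_embedding H (\<lambda>v. f ` K v) (\<lambda>e. f ` path_image (\<gamma> e))"
    by (rule thick_embedding_homeomorphic[OF th chart(1,2)])
      (use sub in \<open>auto simp: H_def delete_edges_def\<close>)
  moreover have real: "complex_of_real (Re (f d)) = f d" if "d \<in> {d1, d2, d3}" for d
  proof -
    have "d \<in> ?X" using that X by blast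
    then have "Im (f d) = 0" using chart(4) that by blast
    then show ?thesis by (simp add: complex_eq_iff)
  qed
  moreover have "\<forall>w \<in> \<Union> ((\<lambda>v. f ` K v) ` verts H) \<union> \<Union> ((\<lambda>e. f ` path_image (\<gamma> e)) ` edges H).
      \<bar>Re w\<bar> < 1 \<and> Im w \<le> 0 \<and> (Im w = 0 \<longrightarrow> w \<in> {f d1, f d2, f d3})"
  proof
    fix w assume "w \<in> \<Union> ((\<lambda>v. f ` K v) ` verts H) \<union> \<Union> ((\<lambda>e. f ` path_image (\<gamma> e)) ` edges H)"
    then obtain z where "z \<in> ?X" "w = f z" by blast
    then show "\<bar>Re w\<bar> < 1 \<and> Im w \<le> 0 \<and> (Im w = 0 \<longrightarrow> w \<in> {f d1, f d2, f d3})"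
      using f(4) chart(3,4)[of z] by auto
  qed
  ultimately show ?thesis
    using f(2,3) d
    by (intro exI[of _ "\<lambda>v. f ` K v"] exI[of _ "\<lambda>e. f ` path_image (\<gamma> e)"] exI[of _ "Re (f d1)"]
        exI[of _ "Re (f d2)"] exI[of _ "Re (f d3)"]) simp
qed

section \<open>Colourings of the composition\<close>

lemma colorable_mono: "colorable k G \<Longrightarrow> k \<le> l \<Longrightarrow> colorable l G"
  unfolding colorable_def by (meson less_le_trans)

lemma simple_graph_edge:
  assumes "simple_graph G" "{v, w} \<in> edges G"
  shows "v \<in> verts G \<and> w \<in> verts G \<and> v \<noteq> w"
proof -
  have "\<forall>e\<in>edges G. e \<subseteq> verts G \<and> card e = 2" using assms(1) by (simp add: simple_graph_def)
  from bspec[OF this assms(2)] show ?thesis by (cases "v = w") auto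
qed

lemma simple_graph_colorable:
  assumes "simple_graph G"
  shows "\<exists>k. colorable k G"
proof -
  obtain f where f: "bij_betw f (verts G) {0..<card (verts G)}"
    using ex_bij_betw_finite_nat[of "verts G"] assms unfolding simple_graph_def by (elim conjE exE) auto
  have "colorable (card (verts G)) G"
    unfolding colorable_def
  proof (intro exI[of _ f] conjI ballI allI impI)
    fix v assume "v \<in> verts G"
    then show "f v < card (verts G)" using bij_betwE[OF f] by auto
  next
    fix v w assume "{v, w} \<in> edges G"
    then show "f v \<noteq> f w"
      using simple_graph_edge[OF assms] bij_betw_imp_inj_on[OF f] by (metis inj_onD)
  qed
  then show ?thesis by blast
qed

lemma chromatic_number_eq_Suc_iff:
  assumes "simple_graph G"
  shows "chromatic_number G = Suc k \<longleftrightarrow> colorable (Suc k) G \<and> \<not> colorable k G"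
proof
  assume *: "chromatic_number G = Suc k"
  have "colorable (chromatic_number G) G"
    using simple_graph_colorable[OF assms] unfolding chromatic_number_def by (metis LeastI)
  moreover have "\<not> colorable k G"
    using not_less_Least[of k "\<lambda>k. colorable k G"] * unfolding chromatic_number_def by simp
  ultimately show "colorable (Suc k) G \<and> \<not> colorable k G" using * by simp
next
  assume "colorable (Suc k) G \<and> \<not> colorable k G"
  then show "chromatic_number G = Suc k"
    unfolding chromatic_number_def
    by (intro Least_equality) (auto simp: not_less_eq_eq intro: ccontr dest: colorable_mono)
qed

text \<open>One end of \<open>e\<close> takes the new colour \<open>k\<close>. The bound 4 for the
  composition will thus follow from 3-colourability after a deletion.\<close>

lemma colorable_Suc_delete_edge:
  assumes G: "simple_graph G" and e: "e \<in> edges G" and col: "colorable k (delete_edges G {e})"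
  shows "colorable (Suc k) G"
proof -
  obtain c where c: "\<And>v. v \<in> verts G \<Longrightarrow> c v < k"
      "\<And>v w. {v, w} \<in> edges G \<Longrightarrow> {v, w} \<noteq> e \<Longrightarrow> c v \<noteq> c w"
    using col by (auto simp: colorable_def delete_edges_def)
  obtain x y where xy: "e = {x, y}" using e G by (auto simp: simple_graph_def card_2_iff)
  show ?thesis
    unfolding colorable_def
  proof (intro exI[of _ "c(x := k)"] conjI ballI allI impI)
    fix v assume "v \<in> verts G"
    then show "(c(x := k)) v < Suc k" using c(1)[of v] by simp
  next
    fix v w assume vw: "{v, w} \<in> edges G"
    then have "v \<in> verts G" "w \<in> verts G" "v \<noteq> w" using simple_graph_edge[OF G vw] by auto
    then show "(c(x := k)) v \<noteq> (c(x := k)) w"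
      using c(1)[of v] c(1)[of w] c(2)[OF vw] xy by auto
  qed
qed

text \<open>Two transpositions: one takes \<open>p\<close> to \<open>s\<close>, the next takes the
  image of \<open>q\<close> to \<open>t\<close> and leaves \<open>s\<close> alone, because that
  image and \<open>t\<close> both differ from \<open>s\<close>.\<close>

lemma permute_three_colors:
  fixes p q s t :: nat
  assumes "p \<noteq> q" "s \<noteq> t" "p < 3" "q < 3" "s < 3" "t < 3"
  shows "\<exists>\<pi>. inj \<pi> \<and> (\<forall>x<3. \<pi> x < 3) \<and> \<pi> p = s \<and> \<pi> q = t"
proof -
  define \<sigma> where "\<sigma> = Transposition.transpose p s"
  define \<pi> where "\<pi> = Transposition.transpose (\<sigma> q) t \<circ> \<sigma>"
  have "inj \<pi>" unfolding \<pi>_def \<sigma>_def by (intro inj_compose) simp_all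
  moreover have "\<forall>x<3. \<pi> x < 3" using assms by (auto simp: \<pi>_def \<sigma>_def Transposition.transpose_def)
  moreover have "\<pi> p = s" "\<pi> q = t" using assms by (auto simp: \<pi>_def \<sigma>_def Transposition.transpose_def)
  ultimately show ?thesis by blast
qed

definition three_coloring :: "'a graph \<Rightarrow> ('a \<Rightarrow> nat) \<Rightarrow> bool" where
  "three_coloring G c \<longleftrightarrow> (\<forall>v\<in>verts G. c v < 3) \<and> (\<forall>v w. {v, w} \<in> edges G \<longrightarrow> c v \<noteq> c w)"

text \<open>The last clause keeps the partition into colour classes and so carries over facts about
  a third vertex.\<close>

lemma three_coloring_prescribe:
  assumes c: "three_coloring G c" and xy: "x \<in> verts G" "y \<in> verts G" "c x \<noteq> c y"
    and st: "s \<noteq> t" "s < 3" "t < 3"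
  shows "\<exists>c'. three_coloring G c' \<and> c' x = s \<and> c' y = t \<and> (\<forall>v w. c' v = c' w \<longleftrightarrow> c v = c w)"
proof -
  have "c x < 3" "c y < 3" using c xy by (auto simp: three_coloring_def)
  then obtain \<pi> where \<pi>: "inj \<pi>" "\<forall>x<3. \<pi> x < 3" "\<pi> (c x) = s" "\<pi> (c y) = t"
    using permute_three_colors[OF xy(3) st(1)] st by blast
  have eq: "\<pi> (c v) = \<pi> (c w) \<longleftrightarrow> c v = c w" for v w using \<pi>(1) by (simp add: inj_eq)
  have "three_coloring G (\<pi> \<circ> c)"
    using c \<pi>(2) unfolding three_coloring_def by (simp add: eq)
  then show ?thesis using \<pi> eq by (intro exI[of _ "\<pi> \<circ> c"]) simp
qed

definition cyc_succ :: "nat \<Rightarrow> nat \<Rightarrow> nat" where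
  "cyc_succ n i = (if i = n then 1 else i + 1)"

text \<open>Without \<open>z\<close> only two colours are left, so \<open>f\<close> alternates along
  1, ..., \<open>n\<close> and agrees at the odd places 1 and \<open>n\<close>, which are cyclic
  neighbours.\<close>

lemma odd_cycle_alternating:
  fixes f :: "nat \<Rightarrow> nat"
  assumes "odd n" and bd: "\<And>i. i \<in> {1..n} \<Longrightarrow> f i < 3 \<and> f i \<noteq> z"
    and ne: "\<And>i. i \<in> {1..n} \<Longrightarrow> f (cyc_succ n i) \<noteq> f i" and z: "z < 3"
  shows False
proof -
  have "n \<ge> 1" using \<open>odd n\<close> by (cases n) auto
  have "i \<le> n \<Longrightarrow> f i = f 1 \<longleftrightarrow> odd i" if "1 \<le> i" for i
    using that
  proof (induction i rule: dec_induct)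
    case base
    then show ?case by simp
  next
    case (step i)
    then have "f (Suc i) \<noteq> f i" using ne[of i] by (simp add: cyc_succ_def)
    moreover have "f (Suc i) < 3 \<and> f (Suc i) \<noteq> z" "f i < 3 \<and> f i \<noteq> z" "f 1 < 3 \<and> f 1 \<noteq> z"
      using bd[of "Suc i"] bd[of i] bd[of 1] step by auto
    ultimately have "f (Suc i) = f 1 \<longleftrightarrow> f i \<noteq> f 1" using z by linarith
    then show ?case using step by simp
  qed
  then have "f n = f 1" using \<open>odd n\<close> \<open>n \<ge> 1\<close> by simp
  then show False using ne[of n] \<open>n \<ge> 1\<close> by (simp add: cyc_succ_def)
qed

lemma odd_cycle_one_defect:
  assumes "odd n" "i \<in> {1..n}"
  shows "\<exists>f :: nat \<Rightarrow> nat. (\<forall>j. f j < 2) \<and> (\<forall>j\<in>{1..n} - {i}. f j \<noteq> f (cyc_succ n j)) \<and> f i = f (cyc_succ n i)"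
proof -
  \<comment> \<open>The parity is shifted up to \<open>i\<close>, so the alternation stalls exactly
    between \<open>i\<close> and its successor; as \<open>n\<close> is odd, the step from
    \<open>n\<close> to 1 is proper unless \<open>i = n\<close>.\<close>
  define f where "f j = (if j \<le> i then j + 1 else j) mod 2" for j :: nat
  have p: "(a + 1) mod 2 \<noteq> a mod (2::nat)" "(a + 2) mod 2 = a mod (2::nat)" for a by presburger+
  have "f j \<noteq> f (cyc_succ n j)" if j: "j \<in> {1..n} - {i}" for j
  proof (cases "j = n")
    case True
    then have "f j = 1" "f 1 = 0" using assms j by (auto simp: f_def odd_iff_mod_2_eq_one)
    then show ?thesis using True by (simp add: cyc_succ_def)
  next
    case False
    then show ?thesis using j p(1)[of j] p(1)[of "j + 1"] by (auto simp: f_def cyc_succ_def)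
  qed
  moreover have "f i = f (cyc_succ n i)"
    using assms by (auto simp: f_def cyc_succ_def)
  ultimately show ?thesis by (intro exI[of _ f]) (auto simp: f_def)
qed

section \<open>The glued graph: classes, vertices and edges\<close>

text \<open>Three pieces at least: with two, both ends of one piece would be glued to the other one,
  and different edges could be merged.\<close>

locale circ_chain =
  fixes n :: nat and G :: "nat \<Rightarrow> 'a graph" and u :: "nat \<Rightarrow> nat \<Rightarrow> 'a"
  assumes n3: "n \<ge> 3"
    and simple: "i \<in> {1..n} \<Longrightarrow> simple_graph (G i)"
    and disjoint: "i \<in> {1..n} \<Longrightarrow> j \<in> {1..n} \<Longrightarrow> i \<noteq> j \<Longrightarrow> verts (G i) \<inter> verts (G j) = {}"
    and dist: "i \<in> {1..n} \<Longrightarrow> distinct [u i 1, u i 2, u i 3]"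
    and path_edges: "i \<in> {1..n} \<Longrightarrow> {u i 1, u i 2} \<in> edges (G i) \<and> {u i 2, u i 3} \<in> edges (G i)"
begin

abbreviation "nx \<equiv> cyc_succ n"

definition cls :: "'a \<Rightarrow> 'a set" where "cls v = {w. equivclp (glue n u) v w}"

definition H :: "nat \<Rightarrow> 'a graph" where "H i = delete_edges (G i) {{u i 2, u i 3}}"

abbreviation "C \<equiv> circ_compose n G u"

lemma nx: "i \<in> {1..n} \<Longrightarrow> nx i \<in> {1..n}" "i \<in> {1..n} \<Longrightarrow> nx i \<noteq> i"
   "i \<in> {1..n} \<Longrightarrow> nx (nx i) \<noteq> i"
  using n3 by (auto simp: cyc_succ_def)

lemma nx_inj: "i \<in> {1..n} \<Longrightarrow> j \<in> {1..n} \<Longrightarrow> nx i = nx j \<Longrightarrow> i = j"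
  by (cases "i = n"; cases "j = n") (auto simp: cyc_succ_def)

lemma nx_surj: "i \<in> {1..n} \<Longrightarrow> \<exists>j\<in>{1..n}. nx j = i"
  using n3 by (intro bexI[of _ "if i = 1 then n else i - 1"]) (auto simp: cyc_succ_def)

lemma idx_unique: "v \<in> verts (G i) \<Longrightarrow> v \<in> verts (G j) \<Longrightarrow> i \<in> {1..n} \<Longrightarrow> j \<in> {1..n} \<Longrightarrow> i = j"
  using disjoint by blast

lemma edge_sub: "i \<in> {1..n} \<Longrightarrow> e \<in> edges (G i) \<Longrightarrow> e \<subseteq> verts (G i) \<and> card e = 2"
  using simple by (auto simp: simple_graph_def)

lemma u_in: "i \<in> {1..n} \<Longrightarrow> u i 1 \<in> verts (G i)" "i \<in> {1..n} \<Longrightarrow> u i 2 \<in> verts (G i)"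
    "i \<in> {1..n} \<Longrightarrow> u i 3 \<in> verts (G i)"
  using edge_sub path_edges by blast+

lemma u_ne: "i \<in> {1..n} \<Longrightarrow> u i 1 \<noteq> u i 2 \<and> u i 2 \<noteq> u i 3 \<and> u i 1 \<noteq> u i 3"
  using dist by auto

lemma verts_H [simp]: "verts (H i) = verts (G i)"
  by (simp add: H_def delete_edges_def)

lemma edges_H: "e \<in> edges (H i) \<longleftrightarrow> e \<in> edges (G i) \<and> e \<noteq> {u i 2, u i 3}"
  by (auto simp: H_def delete_edges_def)

lemma glue_iff: "glue n u x y \<longleftrightarrow> (\<exists>i\<in>{1..n}. x = u i 3 \<and> y = u (nx i) 1)"
  by (simp add: glue_def cyc_succ_def)

lemma u3_ne_u1: "i \<in> {1..n} \<Longrightarrow> j \<in> {1..n} \<Longrightarrow> u i 3 \<noteq> u j 1"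
  using idx_unique u_in u_ne by metis

lemma u_inj: "i \<in> {1..n} \<Longrightarrow> j \<in> {1..n} \<Longrightarrow> u i 3 = u j 3 \<Longrightarrow> i = j"
   "i \<in> {1..n} \<Longrightarrow> j \<in> {1..n} \<Longrightarrow> u i 1 = u j 1 \<Longrightarrow> i = j"
  using idx_unique u_in by metis+

text \<open>\<open>glue n u\<close> cannot be chained: no \<open>u i 3\<close> is a
  \<open>u j 1\<close>, and each vertex is glued to at most one other. So the generated equivalence
  adds only reflexivity and symmetry.\<close>

lemma equiv_glue: "equivclp (glue n u) v w \<longleftrightarrow> v = w \<or> glue n u v w \<or> glue n u w v"
proof
  assume "equivclp (glue n u) v w"
  then show "v = w \<or> glue n u v w \<or> glue n u w v"
  proof (induction rule: equivclp_induct)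
    case base
    then show ?case by simp
  next
    case (step y z)
    have a: "\<not> (glue n u a b \<and> glue n u b c)" for a b c
      using u3_ne_u1 nx(1) unfolding glue_iff by metis
    have b: "a = c" if "glue n u a b" "glue n u c b" for a b c
      using that u_inj(2) nx nx_inj unfolding glue_iff by metis
    have c: "b = c" if "glue n u a b" "glue n u a c" for a b c
      using that u_inj(1) unfolding glue_iff by metis
    show ?case using step(2,3) a b c by metis
  qed
next
  assume "v = w \<or> glue n u v w \<or> glue n u w v"
  then show "equivclp (glue n u) v w"
    by (auto intro: r_into_equivclp equivclp_sym)
qed

lemma in_cls_iff: "w \<in> cls v \<longleftrightarrow> v = w \<or> glue n u v w \<or> glue n u w v"
  by (simp add: cls_def equiv_glue)

lemma cls_self: "v \<in> cls v"
  by (simp add: in_cls_iff)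

lemma cls_eq: "w \<in> cls v \<Longrightarrow> cls w = cls v"
  unfolding cls_def by (auto intro: equivclp_trans equivclp_sym)

lemma cls_glue: "i \<in> {1..n} \<Longrightarrow> cls (u (nx i) 1) = cls (u i 3)"
  by (intro cls_eq) (auto simp: in_cls_iff glue_iff)

text \<open>The basic tool for the quotient: a nontrivial coincidence of classes is a single gluing
  of cyclic neighbours, read in one of its two directions.\<close>

lemma cls_eq_cases:
  assumes eq: "cls v = cls w" and v: "v \<in> verts (G i)" "i \<in> {1..n}" and w: "w \<in> verts (G j)" "j \<in> {1..n}"
  shows "i = j \<and> v = w \<or> i \<noteq> j \<and> j = nx i \<and> v = u i 3 \<and> w = u j 1 \<or> i \<noteq> j \<and> i = nx j \<and> w = u j 3 \<and> v = u i 1"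
proof -
  have "w \<in> cls v" using eq cls_self[of w] by simp
  then consider "v = w" | "glue n u v w" | "glue n u w v" unfolding in_cls_iff by blast
  then show ?thesis
  proof cases
    case 1
    then show ?thesis using idx_unique v w by blast
  next
    case 2
    then obtain l where l: "l \<in> {1..n}" "v = u l 3" "w = u (nx l) 1" unfolding glue_iff by blast
    then have "l = i" "nx l = j" using idx_unique u_in nx(1) v w by metis+
    then show ?thesis using l nx(2)[of i] by auto
  next
    case 3
    then obtain l where l: "l \<in> {1..n}" "w = u l 3" "v = u (nx l) 1" unfolding glue_iff by blast
    then have "l = j" "nx l = i" using idx_unique u_in nx(1) v w by metis+
    then show ?thesis using l nx(2)[of j] by auto
  qed
qed

lemma cls_inj: "i \<in> {1..n} \<Longrightarrow> inj_on cls (verts (G i))"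
  using cls_eq_cases[of _ _ i i] by (intro inj_onI) blast

text \<open>Two common classes would make \<open>j\<close> both successor and predecessor of
  \<open>i\<close>, which a cycle of length at least 3 forbids.\<close>

lemma cls_share_at_most_one:
  assumes "cls v = cls v'" "cls w = cls w'" "v \<noteq> w" "i \<noteq> j" "i \<in> {1..n}" "j \<in> {1..n}"
    and "v \<in> verts (G i)" "w \<in> verts (G i)" "v' \<in> verts (G j)" "w' \<in> verts (G j)"
  shows False
  using cls_eq_cases[OF assms(1,7,5,9,6)] cls_eq_cases[OF assms(2,8,5,10,6)] assms nx(3) by metis

text \<open>The gluing creates no parallel edges, so an edge of the composition determines its
  piece; the drawing of edges relies on this.\<close>

lemma cls_image_edge_inj:
  assumes e: "e \<in> edges (G i)" "i \<in> {1..n}" and e': "e' \<in> edges (G j)" "j \<in> {1..n}"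
    and eq: "cls ` e = cls ` e'"
  shows "i = j \<and> e = e'"
proof (cases "i = j")
  case True
  then show ?thesis
    using inj_on_image_eq_iff[OF cls_inj[OF e(2)]] edge_sub[OF e(2,1)] edge_sub[OF e'(2,1)] eq by simp
next
  case False
  obtain v w where vw: "e = {v, w}" "v \<noteq> w" using edge_sub[OF e(2,1)] by (auto simp: card_2_iff)
  then have "cls v \<in> cls ` e'" "cls w \<in> cls ` e'" using eq by blast+
  then obtain v' w' where "v' \<in> e'" "cls v = cls v'" "w' \<in> e'" "cls w = cls w'" by (elim imageE) 
  then have False
    using cls_share_at_most_one[of v v' w w' i j] False vw e e' edge_sub[OF e(2,1)] edge_sub[OF e'(2,1)] by blast
  then show ?thesis ..
qed

lemma verts_C: "verts C = insert None (Some ` cls ` (\<Union>i\<in>{1..n}. verts (G i)))"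
  by (simp add: circ_compose_def add_vertex_def identify_def union_graph_def delete_edges_def cls_def[abs_def] Let_def)

lemma edges_C: "edges C = {Some ` cls ` e |e i. i \<in> {1..n} \<and> e \<in> edges (H i)} \<union>
    (\<lambda>i. {None, Some (cls (u i 2))}) ` {1..n}"
proof -
  have "(\<Union>i\<in>{1..n}. edges (G i)) - (\<lambda>i. {u i 2, u i 3}) ` {1..n} = (\<Union>i\<in>{1..n}. edges (H i))"
  proof (rule antisym; rule subsetI)
    fix e assume "e \<in> (\<Union>i\<in>{1..n}. edges (G i)) - (\<lambda>i. {u i 2, u i 3}) ` {1..n}"
    then show "e \<in> (\<Union>i\<in>{1..n}. edges (H i))" by (auto simp: edges_H)
  next
    fix e assume "e \<in> (\<Union>i\<in>{1..n}. edges (H i))"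
    then obtain i where i: "i \<in> {1..n}" "e \<in> edges (G i)" "e \<noteq> {u i 2, u i 3}"
      unfolding UN_iff edges_H by blast
    \<comment> \<open>All edges \<open>{u j 2, u j 3}\<close> are removed from the union at once,
      but only the one of piece \<open>i\<close> can lie in \<open>G i\<close>.\<close>
    have "e \<noteq> {u j 2, u j 3}" if j: "j \<in> {1..n}" for j
    proof
      assume *: "e = {u j 2, u j 3}"
      then have "u j 2 \<in> verts (G i)" using edge_sub[OF i(1,2)] by simp
      then have "i = j" using idx_unique u_in(2) i(1) j by blast
      then show False using * i(3) by simp
    qed
    then show "e \<in> (\<Union>i\<in>{1..n}. edges (G i)) - (\<lambda>i. {u i 2, u i 3}) ` {1..n}" using i by blast
  qed
  then have "edges C = (`) Some ` (`) cls ` (\<Union>i\<in>{1..n}. edges (H i)) \<union> (\<lambda>w. {None, Some w}) ` (\<lambda>i. cls (u i 2)) ` {1..n}"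
    by (simp add: circ_compose_def add_vertex_def identify_def union_graph_def delete_edges_def cls_def[abs_def] Let_def)
  also have "(`) Some ` (`) cls ` (\<Union>i\<in>{1..n}. edges (H i)) = {Some ` cls ` e |e i. i \<in> {1..n} \<and> e \<in> edges (H i)}"
    by blast
  finally show ?thesis by (simp only: image_image)
qed

lemma edges_C_cases:
  assumes "e \<in> edges C"
  obtains (piece) i e0 where "i \<in> {1..n}" "e0 \<in> edges (H i)" "e = Some ` cls ` e0"
    | (spoke) i where "i \<in> {1..n}" "e = {None, Some (cls (u i 2))}"
  using assms unfolding edges_C by blast

lemma simple_graph_C: "simple_graph C"
  unfolding simple_graph_def
proof (intro conjI ballI)
  show "finite (verts C)"
    unfolding verts_C using simple by (auto simp: simple_graph_def)
  fix e assume "e \<in> edges C"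
  then show "e \<subseteq> verts C"
  proof (cases rule: edges_C_cases)
    case (piece i e0)
    then have "e0 \<subseteq> verts (G i)" using edge_sub edges_H by blast
    then show ?thesis using piece unfolding verts_C by blast
  next
    case (spoke i)
    then show ?thesis using u_in(2) unfolding verts_C by blast
  qed
  show "card e = 2"
    using \<open>e \<in> edges C\<close>
  proof (cases rule: edges_C_cases)
    case (piece i e0)
    then have e0: "e0 \<subseteq> verts (G i)" "card e0 = 2" using edge_sub edges_H by blast+
    then have "card (cls ` e0) = 2" using card_image inj_on_subset[OF cls_inj[OF piece(1)]] by metis
    then show ?thesis using piece(3) by (simp add: card_image)
  qed simp
qed

text \<open>Colourings of the pieces fit together once the joints have prescribed colours:
  \<open>f j\<close> is the colour where piece \<open>j\<close> is joined to its predecessor. The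
  centre has colour 2, and only \<open>e\<close> may be violated.\<close>

lemma colorable_C_delete:
  fixes c :: "nat \<Rightarrow> 'a \<Rightarrow> nat" and f :: "nat \<Rightarrow> nat"
  assumes bd: "\<And>j v. j \<in> {1..n} \<Longrightarrow> v \<in> verts (G j) \<Longrightarrow> c j v < 3"
    and u1: "\<And>j. j \<in> {1..n} \<Longrightarrow> c j (u j 1) = f j" and u3: "\<And>j. j \<in> {1..n} \<Longrightarrow> c j (u j 3) = f (nx j)"
    and proper: "\<And>j v w. j \<in> {1..n} \<Longrightarrow> {v, w} \<in> edges (H j) \<Longrightarrow> Some ` cls ` {v, w} \<noteq> e \<Longrightarrow> c j v \<noteq> c j w"
    and spoke: "\<And>j. j \<in> {1..n} \<Longrightarrow> {None, Some (cls (u j 2))} \<noteq> e \<Longrightarrow> c j (u j 2) \<noteq> 2"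
  shows "colorable 3 (delete_edges C {e})"
proof -
  \<comment> \<open>The choice does not depend on the representative: \<open>u1\<close> and
    \<open>u3\<close> make neighbouring pieces agree at their joint.\<close>
  define ch where "ch x = (case x of None \<Rightarrow> 2 | Some S \<Rightarrow> (SOME k. \<exists>j\<in>{1..n}. \<exists>v\<in>verts (G j). S = cls v \<and> k = c j v))"
    for x :: "'a set option"
  have ch_None: "ch None = 2" by (simp add: ch_def)
  have ch_Some: "ch (Some (cls v)) = c j v" if j: "j \<in> {1..n}" and v: "v \<in> verts (G j)" for j v
  proof -
    have "c j' v' = c j v" if "j' \<in> {1..n}" "v' \<in> verts (G j')" "cls v = cls v'" for j' v'
      using cls_eq_cases[OF that(3) v j that(2,1)] u1 u3 j that(1) by metis
    then have "(SOME k. \<exists>j\<in>{1..n}. \<exists>v'\<in>verts (G j). cls v = cls v' \<and> k = c j v') = c j v"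
      using j v by (intro some_equality) blast+
    then show ?thesis by (simp add: ch_def)
  qed
  have *: "ch x \<noteq> ch y" if e': "e' \<in> edges C" "e' \<noteq> e" "e' = {x, y}" for e' x y
    using e'(1)
  proof (cases rule: edges_C_cases)
    case (piece i e0)
    obtain v w where vw: "e0 = {v, w}" using piece edge_sub edges_H by (metis card_2_iff)
    then have V: "v \<in> verts (G i)" "w \<in> verts (G i)" using piece edge_sub edges_H by blast+
    have "c i v \<noteq> c i w" using proper[of i v w] piece vw e'(2) by simp
    then have ne: "ch (Some (cls v)) \<noteq> ch (Some (cls w))"
      using ch_Some[OF piece(1) V(1)] ch_Some[OF piece(1) V(2)] by simp
    have "{x, y} = {Some (cls v), Some (cls w)}" using piece(3) vw e'(3) by simp
    then show ?thesis using ne by (auto simp: doubleton_eq_iff)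
  next
    case (spoke i)
    then have "c i (u i 2) \<noteq> 2" using assms(5)[of i] e'(2) by simp
    then have ne: "ch None \<noteq> ch (Some (cls (u i 2)))"
      using ch_Some[OF spoke(1) u_in(2)[OF spoke(1)]] ch_None by simp
    have "{x, y} = {None, Some (cls (u i 2))}" using spoke(2) e'(3) by simp
    then show ?thesis using ne by (auto simp: doubleton_eq_iff)
  qed
  show ?thesis
    unfolding colorable_def
  proof (intro exI[of _ ch] conjI ballI allI impI)
    fix x assume "x \<in> verts (delete_edges C {e})"
    then have "x \<in> verts C" by (simp add: delete_edges_def)
    then consider "x = None" | j v where "j \<in> {1..n}" "v \<in> verts (G j)" "x = Some (cls v)"
      unfolding verts_C by blast
    then show "ch x < 3" using bd ch_Some ch_None by cases auto
  next
    fix x y assume "{x, y} \<in> edges (delete_edges C {e})"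
    then show "ch x \<noteq> ch y" using * by (simp add: delete_edges_def)
  qed
qed

end

section \<open>Criticality of the composition\<close>

locale circ_chain_critical = circ_chain +
  assumes odd_n: "odd n" and crit: "i \<in> {1..n} \<Longrightarrow> four_critical (G i)"
begin

lemma not_colorable_G: "i \<in> {1..n} \<Longrightarrow> \<not> colorable 3 (G i)"
  using crit chromatic_number_eq_Suc_iff[OF simple, of i 3] by (auto simp: four_critical_def)

lemma H_coloring_forced:
  assumes i: "i \<in> {1..n}" and c: "three_coloring (H i) c"
  shows "c (u i 2) = c (u i 3)"
proof (rule ccontr)
  assume ne: "c (u i 2) \<noteq> c (u i 3)"
  have "colorable 3 (G i)"
    unfolding colorable_def
  proof (intro exI[of _ c] conjI ballI allI impI)
    fix v assume "v \<in> verts (G i)"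
    then show "c v < 3" using c by (simp add: three_coloring_def)
  next
    fix v w assume "{v, w} \<in> edges (G i)"
    then show "c v \<noteq> c w"
      using c ne unfolding three_coloring_def edges_H by (metis doubleton_eq_iff)
  qed
  then show False using not_colorable_G[OF i] by simp
qed

lemma H_edge12: "i \<in> {1..n} \<Longrightarrow> {u i 1, u i 2} \<in> edges (H i)"
  using path_edges u_ne by (auto simp: edges_H doubleton_eq_iff)

lemma not_colorable_C: "\<not> colorable 3 C"
proof
  assume "colorable 3 C"
  then obtain c :: "'a set option \<Rightarrow> nat" where bd: "\<And>x. x \<in> verts C \<Longrightarrow> c x < 3" and pr: "\<And>x y. {x, y} \<in> edges C \<Longrightarrow> c x \<noteq> c y"
    by (auto simp: colorable_def)
  define d where "d v = c (Some (cls v))" for v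
  define f where "f i = d (u i 1)" for i
  have cH: "three_coloring (H i) d" if i: "i \<in> {1..n}" for i
    unfolding three_coloring_def
  proof (intro conjI ballI allI impI)
    fix v assume "v \<in> verts (H i)"
    then have "Some (cls v) \<in> verts C" using i unfolding verts_C verts_H by blast
    then show "d v < 3" using bd unfolding d_def by blast
  next
    fix v w assume "{v, w} \<in> edges (H i)"
    then have "Some ` cls ` {v, w} \<in> edges C" using i unfolding edges_C by blast
    then show "d v \<noteq> d w" using pr unfolding d_def by simp
  qed
  have f_next: "f (nx i) = d (u i 2)" if i: "i \<in> {1..n}" for i
    using H_coloring_forced[OF i cH[OF i]] cls_glue[OF i] by (simp add: f_def d_def)
  show False
  proof (rule odd_cycle_alternating[OF odd_n, of f "c None"])
    show "c None < 3" using bd by (simp add: verts_C)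
    fix i assume i: "i \<in> {1..n}"
    have "d (u i 1) \<noteq> d (u i 2)" using cH[OF i] H_edge12[OF i] by (simp add: three_coloring_def)
    then show "f (nx i) \<noteq> f i" using f_next[OF i] by (simp add: f_def)
    \<comment> \<open>The vertex \<open>u i 1\<close> is identified with the \<open>u j 3\<close> of
      the preceding piece and so has the colour of \<open>u j 2\<close>, a neighbour of the
      centre.\<close>
    obtain j where j: "j \<in> {1..n}" "nx j = i" using nx_surj[OF i] by blast
    have "{None, Some (cls (u j 2))} \<in> edges C" using j unfolding edges_C by blast
    then have "d (u j 2) \<noteq> c None" using pr unfolding d_def by metis
    moreover have "d (u j 2) < 3" using cH[OF j(1)] u_in(2)[OF j(1)] by (simp add: three_coloring_def)
    ultimately show "f i < 3 \<and> f i \<noteq> c None" using f_next[OF j(1)] j(2) by simp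
  qed
qed

lemma colorable_delete_G:
  assumes "i \<in> {1..n}" "e \<in> edges (G i)"
  shows "\<exists>c. three_coloring (delete_edges (G i) {e}) c"
  using crit[OF assms(1)] assms(2) unfolding four_critical_def colorable_def three_coloring_def by blast

text \<open>Criticality gives some 3-colouring without the edge \<open>{u i 2, u i 3}\<close>;
  renaming the colours prescribes two values, and the third is forced.\<close>

lemma H_coloring_prescribe:
  assumes i: "i \<in> {1..n}" and st: "s < 3" "t < 3" "s \<noteq> t"
  shows "\<exists>c. three_coloring (H i) c \<and> c (u i 1) = s \<and> c (u i 2) = t \<and> c (u i 3) = t"
proof -
  obtain c where c: "three_coloring (H i) c"
    using colorable_delete_G[OF i] path_edges[OF i] unfolding H_def by blast
  have "c (u i 1) \<noteq> c (u i 2)" using c H_edge12[OF i] by (simp add: three_coloring_def)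
  then show ?thesis
    using three_coloring_prescribe[OF c _ _ _ st(3) st(1,2), of "u i 1" "u i 2"] u_in[OF i]
      H_coloring_forced[OF i] by (metis verts_H)
qed

text \<open>The spokes at all pieces other than \<open>i\<close> force the colour 2 of the centre away from all
  glued vertices except \<open>u i 3\<close>, whose colour is free.\<close>

lemma colorable_C_defect:
  fixes ci :: "'a \<Rightarrow> nat" and f :: "nat \<Rightarrow> nat"
  assumes i: "i \<in> {1..n}" and f: "\<And>j. j \<in> {1..n} \<Longrightarrow> f j < 3"
    and ne: "\<And>j. j \<in> {1..n} \<Longrightarrow> j \<noteq> i \<Longrightarrow> f j \<noteq> f (nx j) \<and> f (nx j) \<noteq> 2"
    and ci: "\<And>v. v \<in> verts (G i) \<Longrightarrow> ci v < 3" "ci (u i 1) = f i" "ci (u i 3) = f (nx i)"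
    and proper: "\<And>v w. {v, w} \<in> edges (H i) \<Longrightarrow> Some ` cls ` {v, w} \<noteq> e \<Longrightarrow> ci v \<noteq> ci w"
    and spoke: "{None, Some (cls (u i 2))} \<noteq> e \<Longrightarrow> ci (u i 2) \<noteq> 2"
  shows "colorable 3 (delete_edges C {e})"
proof -
  have "\<exists>c. three_coloring (H j) c \<and> c (u j 1) = f j \<and> c (u j 2) = f (nx j) \<and> c (u j 3) = f (nx j)"
    if "j \<in> {1..n}" "j \<noteq> i" for j
    using H_coloring_prescribe[OF that(1)] f nx(1) ne that by blast
  then obtain c where c: "\<And>j. j \<in> {1..n} \<Longrightarrow> j \<noteq> i \<Longrightarrow> three_coloring (H j) (c j) \<and>
      c j (u j 1) = f j \<and> c j (u j 2) = f (nx j) \<and> c j (u j 3) = f (nx j)"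
    by metis
  show ?thesis
  proof (rule colorable_C_delete[where f = f and c = "c(i := ci)"])
    fix j assume j: "j \<in> {1..n}"
    show "(c(i := ci)) j v < 3" if "v \<in> verts (G j)" for v
      using ci(1)[of v] c[OF j] that by (cases "j = i") (auto simp: three_coloring_def)
    show "(c(i := ci)) j (u j 1) = f j" "(c(i := ci)) j (u j 3) = f (nx j)"
      using ci(2,3) c[OF j] by (cases "j = i"; simp)+
    show "(c(i := ci)) j v \<noteq> (c(i := ci)) j w" if "{v, w} \<in> edges (H j)" "Some ` cls ` {v, w} \<noteq> e" for v w
      using proper[of v w] c[OF j] that by (cases "j = i") (auto simp: three_coloring_def)
    show "(c(i := ci)) j (u j 2) \<noteq> 2" if "{None, Some (cls (u j 2))} \<noteq> e"
      using spoke c[OF j] ne[OF j] that by (cases "j = i") auto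
  qed
qed

lemma colorable_C_delete_edge:
  assumes "e \<in> edges C"
  shows "colorable 3 (delete_edges C {e})"
proof -
  \<comment> \<open>Piece \<open>i\<close> is relaxed in one of two ways: it has a colouring, proper
    except at \<open>e\<close>, in which \<open>u i 2\<close> and \<open>u i 3\<close> differ, or
    its spoke is gone. In the first case the colouring is one of \<open>G i\<close> minus an edge,
    where \<open>{u i 2, u i 3}\<close> is still present.\<close>
  have "\<exists>i\<in>{1..n}. \<exists>ci. (\<forall>v\<in>verts (G i). ci v < (3::nat)) \<and> ci (u i 2) \<noteq> ci (u i 3) \<and>
      (\<forall>v w. {v, w} \<in> edges (H i) \<longrightarrow> Some ` cls ` {v, w} \<noteq> e \<longrightarrow> ci v \<noteq> ci w) \<or>
      e = {None, Some (cls (u i 2))}"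
    using assms
  proof (cases rule: edges_C_cases)
    case (piece i e0)
    then obtain c where c: "three_coloring (delete_edges (G i) {e0}) c"
      using colorable_delete_G edges_H by blast
    have "{u i 2, u i 3} \<in> edges (delete_edges (G i) {e0})"
      using path_edges[OF piece(1)] piece(2) by (auto simp: delete_edges_def edges_H)
    moreover have "{v, w} \<in> edges (delete_edges (G i) {e0})"
      if "{v, w} \<in> edges (H i)" "Some ` cls ` {v, w} \<noteq> e" for v w
      using that piece(3) by (auto simp: delete_edges_def edges_H)
    ultimately show ?thesis
      using c piece(1) unfolding three_coloring_def by (intro bexI[of _ i] exI[of _ c]) (auto simp: delete_edges_def)
  next
    case (spoke i)
    then show ?thesis by blast
  qed
  then obtain i where i: "i \<in> {1..n}" and alt: "(\<exists>c. (\<forall>v\<in>verts (G i). c v < (3::nat)) \<and> c (u i 2) \<noteq> c (u i 3) \<and>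
      (\<forall>v w. {v, w} \<in> edges (H i) \<longrightarrow> Some ` cls ` {v, w} \<noteq> e \<longrightarrow> c v \<noteq> c w)) \<or>
      e = {None, Some (cls (u i 2))}"
    by blast
  \<comment> \<open>The joints get colours 0 and 1, alternating except across piece
    \<open>i\<close>.\<close>
  obtain f :: "nat \<Rightarrow> nat" where f: "\<forall>j. f j < 2" "\<forall>j\<in>{1..n} - {i}. f j \<noteq> f (nx j)" "f i = f (nx i)"
    using odd_cycle_one_defect[OF odd_n i] by (elim exE conjE)
  have f3: "f j < 3" "f j \<noteq> 2" for j using f(1)[rule_format, of j] by simp_all
  \<comment> \<open>The alternative gives the joint after piece \<open>i\<close> the centre's colour
    2. The spoke of another piece \<open>j\<close> is not affected, as it sees the colour of the
    joint after \<open>j\<close>.\<close>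
  define f' where "f' = f(nx i := 2)"
  have f'i: "f' i = f i" "f' (nx i) = 2" using nx(2)[OF i] by (auto simp: f'_def)
  have f'3: "f' j < 3" for j using f3 by (simp add: f'_def)
  have f'ne: "f' j \<noteq> f' (nx j) \<and> f' (nx j) \<noteq> 2" if j: "j \<in> {1..n}" "j \<noteq> i" for j
  proof -
    have "nx j \<noteq> nx i" using nx_inj[OF j(1) i] j(2) by blast
    then show ?thesis using f(2) f3 j by (auto simp: f'_def)
  qed
  let ?D = "Graph (verts (G i)) {x \<in> edges (H i). Some ` cls ` x \<noteq> e}"
  show ?thesis
    using alt
  proof
    assume e: "e = {None, Some (cls (u i 2))}"
    \<comment> \<open>Here \<open>u i 2\<close> shares the colour 2 of \<open>u i 3\<close>, which
      is harmless because its spoke is the deleted edge.\<close>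
    obtain c where c: "three_coloring (H i) c" "c (u i 1) = f' i" "c (u i 3) = f' (nx i)"
      using H_coloring_prescribe[OF i f'3[of i] f'3[of "nx i"]] f'i f3 by metis
    show ?thesis
      using c by (intro colorable_C_defect[where f = f' and e = e, OF i f'3 f'ne, where ci = c]) (auto simp: e three_coloring_def)
  next
    assume "\<exists>c. (\<forall>v\<in>verts (G i). c v < (3::nat)) \<and> c (u i 2) \<noteq> c (u i 3) \<and>
      (\<forall>v w. {v, w} \<in> edges (H i) \<longrightarrow> Some ` cls ` {v, w} \<noteq> e \<longrightarrow> c v \<noteq> c w)"
    then obtain c where c: "three_coloring ?D c" "c (u i 2) \<noteq> c (u i 3)"
      by (auto simp: three_coloring_def)
    have V: "u i 1 \<in> verts ?D" "u i 2 \<in> verts ?D" "u i 3 \<in> verts ?D" using u_in[OF i] by auto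
    \<comment> \<open>If \<open>u i 1\<close> and \<open>u i 3\<close> agree, the defect of
      \<open>f\<close> fits them and \<open>u i 2\<close> takes the other one of 0 and 1. Otherwise
      \<open>f'\<close> fits, and \<open>u i 2\<close> avoids 2 because it differs from
      \<open>u i 3\<close>.\<close>
    show ?thesis
    proof (cases "c (u i 1) = c (u i 3)")
      case True
      have "f i \<noteq> 1 - f i" "1 - f i < 3" using f(1) by presburger+
      then obtain c' where c': "three_coloring ?D c'" "c' (u i 3) = f i" "c' (u i 2) = 1 - f i"
          "\<forall>v w. c' v = c' w \<longleftrightarrow> c v = c w"
        using three_coloring_prescribe[OF c(1) V(3,2) c(2)[symmetric] _ f3(1)] by blast
      have c1: "c' (u i 1) = f i" using c'(2,4) True by metis
      show ?thesis
        using c' c1 f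
        by (intro colorable_C_defect[where f = f and e = e and ci = c', OF i f3(1)])
          (auto simp: three_coloring_def f3)
    next
      case False
      have "f' i \<noteq> f' (nx i)" using f'i f3 by simp
      then obtain c' where c': "three_coloring ?D c'" "c' (u i 1) = f' i" "c' (u i 3) = f' (nx i)"
          "\<forall>v w. c' v = c' w \<longleftrightarrow> c v = c w"
        using three_coloring_prescribe[OF c(1) V(1,3) False _ f'3[of i] f'3[of "nx i"]] by blast
      have "c' (u i 2) \<noteq> 2" using c'(3,4) c(2) f'i(2) by metis
      then show ?thesis
        using c' by (intro colorable_C_defect[where f = f' and e = e, OF i f'3 f'ne, where ci = c']) (auto simp: three_coloring_def)
    qed
  qed
qed

lemma four_critical_C: "four_critical C"
proof -
  have "1 \<in> {1..n}" using n3 by simp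
  then have "{None, Some (cls (u 1 2))} \<in> edges C" unfolding edges_C by blast
  then have "colorable 4 C"
    using colorable_Suc_delete_edge[OF simple_graph_C _ colorable_C_delete_edge, of _ ] by fastforce
  then have "chromatic_number C = 4"
    using chromatic_number_eq_Suc_iff[OF simple_graph_C, of 3] not_colorable_C by simp
  then show ?thesis using colorable_C_delete_edge by (simp add: four_critical_def)
qed

end

section \<open>The composition drawn in the plane\<close>

lemma nonsep_continuum_convex:
  assumes "convex K" "compact K" "K \<noteq> {}"
  shows "nonsep_continuum K"
  using assms connected_complement_homeomorphic_convex_compact[OF homeomorphic_refl assms(1,2)]
  by (simp add: nonsep_continuum_def convex_connected)

text \<open>A degenerate box, for which convexity and compactness are immediate.\<close>

definition hseg :: "real \<Rightarrow> real \<Rightarrow> real \<Rightarrow> complex set" where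
  "hseg x y t = cbox (Complex x t) (Complex y t)"

definition vseg :: "real \<Rightarrow> real \<Rightarrow> real \<Rightarrow> complex set" where
  "vseg x s t = cbox (Complex x s) (Complex x t)"

lemma in_hseg: "z \<in> hseg x y t \<longleftrightarrow> x \<le> Re z \<and> Re z \<le> y \<and> Im z = t"
  by (auto simp: hseg_def in_cbox_complex_iff)

lemma in_vseg: "z \<in> vseg x s t \<longleftrightarrow> Re z = x \<and> s \<le> Im z \<and> Im z \<le> t"
  by (auto simp: vseg_def in_cbox_complex_iff)

lemma nonsep_continuum_hseg: "x \<le> y \<Longrightarrow> nonsep_continuum (hseg x y t)"
  by (rule nonsep_continuum_convex) (auto simp: hseg_def in_cbox_complex_iff box_ne_empty Basis_complex_def)

lemma nonsep_continuum_vseg: "s \<le> t \<Longrightarrow> nonsep_continuum (vseg x s t)"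
  by (rule nonsep_continuum_convex) (auto simp: vseg_def in_cbox_complex_iff box_ne_empty Basis_complex_def)

lemma nonsep_continuum_Un_point:
  assumes "nonsep_continuum A" "nonsep_continuum B" "A \<inter> B = {x}"
  shows "nonsep_continuum (A \<union> B)"
  using assms by (intro nonsep_continuum_Un) auto

text \<open>Picture: the pieces hang side by side below the real line, attached to it by three pins
  each; all that is new is drawn on or above the line.\<close>

locale circ_drawing = circ_chain +
  fixes P :: "nat \<Rightarrow> 'a \<Rightarrow> complex set" and B :: "nat \<Rightarrow> 'a set \<Rightarrow> complex set" and a b d :: "nat \<Rightarrow> real"
  assumes thick: "i \<in> {1..n} \<Longrightarrow> thick_embedding (H i) (P i) (B i)"
    and order: "i \<in> {1..n} \<Longrightarrow> 2 * real i - 1 < a i \<and> a i < b i \<and> b i < d i \<and> d i < 2 * real i + 1"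
    and pins: "i \<in> {1..n} \<Longrightarrow> of_real (a i) \<in> P i (u i 1) \<and> of_real (b i) \<in> P i (u i 2) \<and> of_real (d i) \<in> P i (u i 3)"
    and strip: "i \<in> {1..n} \<Longrightarrow> z \<in> \<Union> (P i ` verts (H i)) \<union> \<Union> (B i ` edges (H i)) \<Longrightarrow>
      2 * real i - 1 < Re z \<and> Re z < 2 * real i + 1 \<and> Im z \<le> 0 \<and>
      (Im z = 0 \<longrightarrow> z \<in> {of_real (a i), of_real (b i), of_real (d i)})"
begin

definition D :: "nat \<Rightarrow> complex set" where
  "D i = \<Union> (P i ` verts (H i)) \<union> \<Union> (B i ` edges (H i))"

text \<open>Between neighbours the link fills the gap on the real line. The last one climbs to
  height 2 and returns to the first piece above everything else, which leaves height 1 to the hub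
  and the tops of the spokes.\<close>

definition link :: "nat \<Rightarrow> complex set" where
  "link i = (if i = n then (vseg (d n) 0 2 \<union> hseg (a 1) (d n) 2) \<union> vseg (a 1) 0 2
     else hseg (d i) (a (i + 1)) 0)"

definition spoke :: "nat \<Rightarrow> complex set" where "spoke i = vseg (b i) 0 1"

definition hub :: "complex set" where "hub = hseg (b 1) (b n) 1"

lemma P_D: "v \<in> verts (G i) \<Longrightarrow> P i v \<subseteq> D i"
  by (auto simp: D_def)

lemma B_D: "e \<in> edges (H i) \<Longrightarrow> B i e \<subseteq> D i"
  by (auto simp: D_def)

lemma in_D:
  assumes "i \<in> {1..n}" "z \<in> D i"
  shows "2 * real i - 1 < Re z" "Re z < 2 * real i + 1" "Im z \<le> 0"
    "Im z = 0 \<Longrightarrow> z \<in> {of_real (a i), of_real (b i), of_real (d i)}"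
  using strip[OF assms[unfolded D_def]] by blast+

lemma D_disjoint: "z \<in> D i \<Longrightarrow> z \<in> D j \<Longrightarrow> i \<in> {1..n} \<Longrightarrow> j \<in> {1..n} \<Longrightarrow> i = j"
  using in_D(1,2)[of i z] in_D(1,2)[of j z] by linarith

lemma lt: "i \<in> {1..n} \<Longrightarrow> j \<in> {1..n} \<Longrightarrow> i < j \<Longrightarrow> d i < a j"
  using order[of i] order[of j] by linarith

lemma ends: "1 \<in> {1..n}" "n \<in> {1..n}"
  using n3 by auto

lemma nx_n: "nx n = 1" "i \<noteq> n \<Longrightarrow> nx i = i + 1"
  by (auto simp: cyc_succ_def)

lemma in_link_n: "z \<in> link n \<longleftrightarrow> Re z = d n \<and> 0 \<le> Im z \<and> Im z \<le> 2 \<or> a 1 \<le> Re z \<and> Re z \<le> d n \<and> Im z = 2 \<or>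
    Re z = a 1 \<and> 0 \<le> Im z \<and> Im z \<le> 2"
  by (auto simp: link_def in_hseg in_vseg)

lemma in_link: "i \<noteq> n \<Longrightarrow> z \<in> link i \<longleftrightarrow> d i \<le> Re z \<and> Re z \<le> a (i + 1) \<and> Im z = 0"
  by (auto simp: link_def in_hseg)

text \<open>A link lies on or above the real line and a piece on or below it, so they meet in pins
  only; the order of the pins leaves just the intended ones.\<close>

lemma link_D:
  assumes z: "z \<in> link i" "z \<in> D j" and i: "i \<in> {1..n}" and j: "j \<in> {1..n}"
  shows "j = i \<and> z = of_real (d i) \<or> j = nx i \<and> z = of_real (a j)"
proof -
  have "Im z \<ge> 0" using z(1) in_link_n in_link[of i] by (cases "i = n") auto
  then have Im: "Im z = 0" using in_D(3)[OF j z(2)] by simp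
  then have zj: "Re z = a j \<or> Re z = b j \<or> Re z = d j" using in_D(4)[OF j z(2)] by auto
  have zr: "z = of_real (Re z)" using Im by (simp add: complex_eq_iff)
  have oj: "a j < b j" "b j < d j" using order[OF j] by auto
  have "j = i \<and> Re z = d i \<or> j = nx i \<and> Re z = a j"
  proof (cases "i = n")
    case True
    then have "Re z = d n \<or> Re z = a 1" using z(1) Im by (auto simp: in_link_n)
    moreover have "j = n" if "Re z = d n"
    proof (rule ccontr)
      assume "j \<noteq> n"
      then have "d j < a n" using lt[OF j ends(2)] j by auto
      then show False using order[OF ends(2)] zj oj that by linarith
    qed
    moreover have "j = 1" if "Re z = a 1"
    proof (rule ccontr)
      assume "j \<noteq> 1"
      then have "d 1 < a j" using lt[OF ends(1) j] j by auto
      then show False using order[OF ends(1)] zj oj that by linarith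
    qed
    moreover have "j = 1 \<Longrightarrow> Re z = a 1 \<Longrightarrow> Re z = a j" by simp
    ultimately show ?thesis using True nx_n by metis
  next
    case False
    then have zi: "d i \<le> Re z" "Re z \<le> a (i + 1)" using z(1) in_link by auto
    have i1: "i + 1 \<in> {1..n}" using False i by auto
    consider "j < i" | "j = i" | "j = i + 1" | "j > i + 1" by linarith
    then show ?thesis
    proof cases
      case 1
      then show ?thesis using lt[OF j i 1] order[OF i] zi zj oj by linarith
    next
      case 2
      then have "Re z = d i" using zi zj oj by auto
      then show ?thesis using 2 by simp
    next
      case 3
      then have "Re z = a j" using zi zj oj by auto
      then show ?thesis using 3 nx_n(2)[OF False] by simp
    next
      case 4
      then show ?thesis using lt[OF i1 j 4] order[OF i1] zi zj oj by linarith
    qed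
  qed
  then show ?thesis using zr by metis
qed

lemma link_ends: "i \<in> {1..n} \<Longrightarrow> of_real (d i) \<in> link i" "i \<in> {1..n} \<Longrightarrow> of_real (a (nx i)) \<in> link i"
  using lt[of i "i + 1"] by (cases "i = n"; auto simp: in_link_n in_link nx_n)+

lemma link_disjoint:
  assumes z: "z \<in> link i" "z \<in> link j" and i: "i \<in> {1..n}" and j: "j \<in> {1..n}"
  shows "i = j"
proof -
  have *: False if "i < j" "z \<in> link i" "z \<in> link j" "i \<in> {1..n}" "j \<in> {1..n}" for i j
  proof -
    have "i \<noteq> n" using that by auto
    then have zi: "d i \<le> Re z" "Re z \<le> a (i + 1)" "Im z = 0" using that(2) in_link by auto
    have i1: "i + 1 \<in> {1..n}" using that by auto
    \<comment> \<open>The last link stands on \<open>a 1\<close> and \<open>d n\<close>, outside the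
      range of the other links.\<close>
    have low: "a 1 < d i" using lt[OF ends(1) that(4)] order[OF ends(1)] order[OF that(4)] that(4)
      by (cases "i = 1") auto
    have "a (i + 1) < d j" using lt[OF i1 that(5)] order[OF i1] order[OF that(5)] that(1)
      by (cases "i + 1 = j") auto
    then have "Re z < d j" using zi by linarith
    then show False
      using that(3) zi low in_link[of j] in_link_n by (cases "j = n") auto
  qed
  show ?thesis using *[of i j] *[of j i] z i j by (meson linorder_neqE_nat)
qed

text \<open>Hub and spokes stay strictly between the legs of the last link; this is where
  \<open>b i\<close> has to be the middle pin.\<close>

lemma b_range: "i \<in> {1..n} \<Longrightarrow> b 1 \<le> b i \<and> b i \<le> b n \<and> a 1 < b i \<and> b i < d n"
  using lt[of 1 i] lt[of i n] order[of i] order[of 1] order[of n] ends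
  by (cases "i = 1"; cases "i = n") auto

lemma hub_D: "z \<in> hub \<Longrightarrow> i \<in> {1..n} \<Longrightarrow> z \<notin> D i"
  using in_D(3)[of i z] by (auto simp: hub_def in_hseg)

lemma hub_link: "z \<in> hub \<Longrightarrow> z \<notin> link i"
  using b_range[OF ends(1)] b_range[OF ends(2)]
  by (cases "i = n") (auto simp: hub_def in_hseg in_link_n in_link)

lemma spoke_D:
  assumes "z \<in> spoke i" "z \<in> D j" "i \<in> {1..n}" "j \<in> {1..n}"
  shows "i = j \<and> z = of_real (b i)"
proof -
  have z: "Re z = b i" "Im z = 0" using assms(1) in_D(3)[OF assms(4,2)] by (auto simp: spoke_def in_vseg)
  then have "i = j" using in_D(1,2)[OF assms(4,2)] order[OF assms(3)] by linarith
  then show ?thesis using z by (simp add: complex_eq_iff)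
qed

text \<open>A short link leaves out the stretch between \<open>a i\<close> and \<open>d i\<close>
  where the spoke stands, and the last link passes above its top and beside it.\<close>

lemma spoke_link:
  assumes "z \<in> spoke i" "z \<in> link j" "i \<in> {1..n}" "j \<in> {1..n}"
  shows False
proof -
  have z: "Re z = b i" "Im z \<le> 1" using assms(1) by (auto simp: spoke_def in_vseg)
  show False
  proof (cases "j = n")
    case True
    then show False using z b_range[OF assms(3)] assms(2) by (auto simp: in_link_n)
  next
    case False
    then have "d j \<le> b i" "b i \<le> a (j + 1)" using z assms(2) in_link by auto
    moreover have "j + 1 \<in> {1..n}" using False assms(4) by auto
    ultimately show False
      using lt[OF assms(3,4)] lt[of "j + 1" i] order[OF assms(3)] order[OF assms(4)] order[of "j + 1"] assms(3)
      by (cases "i < j"; cases "i = j"; cases "i = j + 1") auto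
  qed
qed

lemma spoke_disjoint: "z \<in> spoke i \<Longrightarrow> z \<in> spoke j \<Longrightarrow> i \<in> {1..n} \<Longrightarrow> j \<in> {1..n} \<Longrightarrow> i = j"
  using lt[of i j] lt[of j i] order[of i] order[of j]
  by (cases "i < j"; cases "j < i") (auto simp: spoke_def in_vseg)

lemma spoke_ends: "of_real (b i) \<in> spoke i" "i \<in> {1..n} \<Longrightarrow> Complex (b i) 1 \<in> spoke i \<inter> hub"
  using b_range[of i] by (auto simp: spoke_def hub_def in_vseg in_hseg)

text \<open>The three sides of the last link meet successively in single points; being open at the
  bottom, it does not separate.\<close>

lemma nonsep_continuum_link:
  assumes "i \<in> {1..n}"
  shows "nonsep_continuum (link i)"
proof (cases "i = n")
  case True
  have lt1: "a 1 < d n" using b_range[OF ends(1)] by auto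
  have 1: "vseg (d n) 0 2 \<inter> hseg (a 1) (d n) 2 = {Complex (d n) 2}"
    using lt1 by (auto simp: in_vseg in_hseg complex_eq_iff)
  have 2: "(vseg (d n) 0 2 \<union> hseg (a 1) (d n) 2) \<inter> vseg (a 1) 0 2 = {Complex (a 1) 2}"
    using lt1 by (auto simp: in_vseg in_hseg complex_eq_iff)
  have "nonsep_continuum (vseg (d n) 0 2 \<union> hseg (a 1) (d n) 2)"
    using lt1 by (intro nonsep_continuum_Un_point[OF _ _ 1] nonsep_continuum_hseg nonsep_continuum_vseg) auto
  then show ?thesis
    unfolding link_def using True nonsep_continuum_Un_point[OF _ _ 2] nonsep_continuum_vseg by simp
next
  case False
  then have "d i < a (i + 1)" using lt[of i "i + 1"] assms by auto
  then show ?thesis unfolding link_def using False nonsep_continuum_hseg by simp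
qed

section \<open>The fat drawing of the composition\<close>

text \<open>Collecting over all pieces avoids a choice of representatives. A glued vertex consists
  of its two fat vertices and the link between them; which pieces contribute is worked out
  afterwards.\<close>

definition KC :: "'a set option \<Rightarrow> complex set" where
  "KC x = (case x of None \<Rightarrow> hub | Some c \<Rightarrow>
     {z. \<exists>i\<in>{1..n}. \<exists>v\<in>verts (G i). v \<in> c \<and> z \<in> P i v} \<union> {z. \<exists>i\<in>{1..n}. u i 3 \<in> c \<and> z \<in> link i})"

definition AC :: "'a set option set \<Rightarrow> complex set" where
  "AC e = {z. \<exists>i\<in>{1..n}. \<exists>e0\<in>edges (H i). e = Some ` cls ` e0 \<and> z \<in> B i e0} \<union>
     {z. \<exists>i\<in>{1..n}. e = {None, Some (cls (u i 2))} \<and> z \<in> spoke i}"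

lemma KC_None: "KC None = hub"
  by (simp add: KC_def)

lemma KC_Some_cases:
  assumes "z \<in> KC (Some c)"
  obtains (piece) i v where "i \<in> {1..n}" "v \<in> verts (G i)" "v \<in> c" "z \<in> P i v"
    | (link) i where "i \<in> {1..n}" "u i 3 \<in> c" "z \<in> link i"
  using assms unfolding KC_def by auto

lemma P_KC: "i \<in> {1..n} \<Longrightarrow> v \<in> verts (G i) \<Longrightarrow> P i v \<subseteq> KC (Some (cls v))"
  unfolding KC_def using cls_self by auto

lemma P_KC': "i \<in> {1..n} \<Longrightarrow> v \<in> verts (G i) \<Longrightarrow> v \<in> c \<Longrightarrow> P i v \<subseteq> KC (Some c)"
  unfolding KC_def by auto

lemma verts_C_cases:
  assumes "x \<in> verts C"
  obtains (hub) "x = None" | (cls) i v where "i \<in> {1..n}" "v \<in> verts (G i)" "x = Some (cls v)"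
  using assms unfolding verts_C by blast

lemma P_inj: "z \<in> P i v \<Longrightarrow> z \<in> P i w \<Longrightarrow> i \<in> {1..n} \<Longrightarrow> v \<in> verts (G i) \<Longrightarrow> w \<in> verts (G i) \<Longrightarrow> v = w"
  using thick_embeddingD(2)[OF thick, of i v w] by auto

lemma B_meets_P: "i \<in> {1..n} \<Longrightarrow> e \<in> edges (H i) \<Longrightarrow> v \<in> verts (G i) \<Longrightarrow> B i e \<inter> P i v \<noteq> {} \<longleftrightarrow> v \<in> e"
  using thick_embeddingD(4)[OF thick, of i e v] by simp

lemma P_link:
  assumes "z \<in> P i v" "z \<in> link j" "i \<in> {1..n}" "v \<in> verts (G i)" "j \<in> {1..n}"
  shows "v \<in> cls (u j 3) \<and> (i = j \<and> v = u j 3 \<and> z = of_real (d j) \<or> i = nx j \<and> v = u i 1 \<and> z = of_real (a i))"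
proof -
  have "z \<in> D i" using P_D assms by blast
  then consider "i = j" "z = of_real (d j)" | "i = nx j" "z = of_real (a i)"
    using link_D[OF assms(2) _ assms(5,3)] by blast
  then show ?thesis
  proof cases
    case 1
    then have "v = u j 3" using P_inj[OF assms(1) _ assms(3,4) u_in(3)[OF assms(3)]] pins[OF assms(3)] by simp
    then show ?thesis using 1 cls_self by blast
  next
    case 2
    then have v: "v = u i 1" using P_inj[OF assms(1) _ assms(3,4) u_in(1)[OF assms(3)]] pins[OF assms(3)] by simp
    then have "v \<in> cls (u j 3)" using cls_glue[OF assms(5)] cls_self[of v] 2(1) by simp
    then show ?thesis using 2 v by blast
  qed
qed

text \<open>For a glued class three continua are strung together with single contact points, the
  pins at the two ends of the link.\<close>

lemma KC_nonsep:
  assumes "x \<in> verts C"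
  shows "nonsep_continuum (KC x)"
  using assms
proof (cases rule: verts_C_cases)
  case hub
  then show ?thesis using nonsep_continuum_hseg[of "b 1" "b n"] b_range[OF ends(2)] by (simp add: KC_def hub_def)
next
  case (cls i v)
  have P_ns: "nonsep_continuum (P i v)" if "i \<in> {1..n}" "v \<in> verts (G i)" for i v
    using thick_embeddingD(1)[OF thick[OF that(1)]] that by simp
  \<comment> \<open>The glued classes are those containing some \<open>u j 3\<close>, since each
    \<open>u i 1\<close> is glued to the preceding piece; all others are singletons.\<close>
  show ?thesis
  proof (cases "\<exists>j\<in>{1..n}. u j 3 \<in> cls v")
    case True
    then obtain j where j: "j \<in> {1..n}" "cls v = cls (u j 3)" using cls_eq by metis
    have nj: "nx j \<in> {1..n}" by (rule nx(1)[OF j(1)])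
    have mem: "w \<in> cls v \<longleftrightarrow> w = u j 3 \<or> w = u (nx j) 1" if "w \<in> verts (G l)" "l \<in> {1..n}" for w l
    proof
      assume "w \<in> cls v"
      then have "cls (u j 3) = cls w" using j cls_eq by metis
      then show "w = u j 3 \<or> w = u (nx j) 1"
        using cls_eq_cases[of "u j 3" w j l] u_in(3)[OF j(1)] j(1) that u_ne[OF j(1)] by metis
    next
      assume "w = u j 3 \<or> w = u (nx j) 1"
      then show "w \<in> cls v" using j cls_self cls_glue[OF j(1)] by metis
    qed
    have eq: "KC x = (P j (u j 3) \<union> link j) \<union> P (nx j) (u (nx j) 1)"
    proof (rule antisym; rule subsetI)
      fix z assume "z \<in> KC x"
      then have "z \<in> KC (Some (cls v))" using cls(3) by simp
      then show "z \<in> (P j (u j 3) \<union> link j) \<union> P (nx j) (u (nx j) 1)"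
      proof (cases rule: KC_Some_cases)
        case (piece l w)
        then have "w = u j 3 \<or> w = u (nx j) 1" using mem by blast
        moreover have "w = u j 3 \<Longrightarrow> l = j" "w = u (nx j) 1 \<Longrightarrow> l = nx j"
          using idx_unique[OF piece(2) _ piece(1)] u_in(3)[OF j(1)] u_in(1)[OF nj] j(1) nj by auto
        ultimately show ?thesis using piece(4) by auto
      next
        case (link l)
        then have "u l 3 = u j 3" using mem[OF u_in(3)[OF link(1)] link(1)] u3_ne_u1[OF link(1) nj] by blast
        then have "l = j" using u_inj(1) link(1) j(1) by blast
        then show ?thesis using link by blast
      qed
    next
      fix z assume z: "z \<in> (P j (u j 3) \<union> link j) \<union> P (nx j) (u (nx j) 1)"
      have in_c: "u j 3 \<in> cls v" "u (nx j) 1 \<in> cls v"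
        using mem[OF u_in(3)[OF j(1)] j(1)] mem[OF u_in(1)[OF nj] nj] by auto
      have "link j \<subseteq> KC x" using j(1) in_c(1) cls(3) unfolding KC_def by auto
      then show "z \<in> KC x"
        using z P_KC'[OF j(1) u_in(3)[OF j(1)] in_c(1)] P_KC'[OF nj u_in(1)[OF nj] in_c(2)] cls(3) by blast
    qed
    have 1: "P j (u j 3) \<inter> link j = {of_real (d j)}"
    proof -
      have "z = of_real (d j)" if "z \<in> P j (u j 3)" "z \<in> link j" for z
        using P_link[OF that j(1) u_in(3)[OF j(1)] j(1)] nx(2)[OF j(1)] by metis
      then show ?thesis using pins[OF j(1)] link_ends(1)[OF j(1)] by blast
    qed
    have 2: "(P j (u j 3) \<union> link j) \<inter> P (nx j) (u (nx j) 1) = {of_real (a (nx j))}"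
    proof -
      have "z = of_real (a (nx j))" if "z \<in> link j" "z \<in> P (nx j) (u (nx j) 1)" for z
        using P_link[OF that(2,1) nj u_in(1)[OF nj] j(1)] nx(2)[OF j(1)] by metis
      moreover have "z \<notin> P (nx j) (u (nx j) 1)" if "z \<in> P j (u j 3)" for z
      proof
        assume "z \<in> P (nx j) (u (nx j) 1)"
        then have "z \<in> D j" "z \<in> D (nx j)"
          using that P_D[OF u_in(3)[OF j(1)]] P_D[OF u_in(1)[OF nj]] by (auto simp only: subset_iff)
        then show False using D_disjoint j(1) nj nx(2)[OF j(1)] by metis
      qed
      ultimately show ?thesis using pins[OF nj] link_ends(2)[OF j(1)] by blast
    qed
    show ?thesis
      unfolding eq
      by (intro nonsep_continuum_Un_point[OF _ _ 2] nonsep_continuum_Un_point[OF _ _ 1]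
          P_ns nonsep_continuum_link j(1) nj u_in)
  next
    case False
    have "KC x = P i v"
    proof (rule antisym; rule subsetI)
      fix z assume "z \<in> KC x"
      then have "z \<in> KC (Some (cls v))" using cls(3) by simp
      then show "z \<in> P i v"
      proof (cases rule: KC_Some_cases)
        case (piece l w)
        then have "cls v = cls w" using cls_eq by metis
        then have "i = l \<and> v = w"
          using cls_eq_cases[of v w i l] cls(1,2) piece False cls_self by metis
        then show ?thesis using piece by blast
      qed (use False in blast)
    qed (use P_KC[OF cls(1,2)] cls(3) in blast)
    then show ?thesis using P_ns[OF cls(1,2)] by simp
  qed
qed

lemma hub_KC: "z \<in> hub \<Longrightarrow> z \<notin> KC (Some c)"
proof
  assume z: "z \<in> hub" "z \<in> KC (Some c)"
  from z(2) show False
  proof (cases rule: KC_Some_cases)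
    case (piece i v)
    then show False using hub_D[OF z(1) piece(1)] P_D by blast
  next
    case (link i)
    then show False using hub_link[OF z(1)] by blast
  qed
qed

text \<open>A common point yields a vertex in both classes: pieces are disjoint, links are disjoint,
  and where a link meets a fat vertex, that vertex belongs to the class of the link.\<close>

lemma KC_disjoint:
  assumes z: "z \<in> KC x" "z \<in> KC y" and xy: "x \<in> verts C" "y \<in> verts C"
  shows "x = y"
  using xy(1)
proof (cases rule: verts_C_cases)
  case hub
  then show ?thesis using z hub_KC xy(2) KC_None by (metis option.exhaust)
next
  case (cls i v)
  note x = this
  from xy(2) show ?thesis
  proof (cases rule: verts_C_cases)
    case hub
    then show ?thesis using z hub_KC x KC_None by metis
  next
    case (cls j w)
    have share: "cls v = cls w" if "r \<in> cls v" "r \<in> cls w" for r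
      using that cls_eq by metis
    from z(1)[unfolded x(3)] have "cls v = cls w"
    proof (cases rule: KC_Some_cases)
      case (piece i1 v1)
      note p1 = this
      from z(2)[unfolded cls(3)] show ?thesis
      proof (cases rule: KC_Some_cases)
        case (piece i2 v2)
        then have "i1 = i2" using D_disjoint P_D p1 by blast
        then have "v1 = v2" using P_inj p1 piece by blast
        then show ?thesis using share p1 piece by blast
      next
        case (link j2)
        then have "v1 \<in> cls (u j2 3)" using P_link p1 by blast
        then show ?thesis using share p1(3) cls_eq[OF link(2)] by metis
      qed
    next
      case (link j1)
      note l1 = this
      from z(2)[unfolded cls(3)] show ?thesis
      proof (cases rule: KC_Some_cases)
        case (piece i2 v2)
        then have "v2 \<in> cls (u j1 3)" using P_link l1 by blast
        then show ?thesis using share piece(3) cls_eq[OF l1(2)] by metis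
      next
        case (link j2)
        then have "j1 = j2" using link_disjoint l1 by blast
        then show ?thesis using share l1 link by blast
      qed
    qed
    then show ?thesis using x cls by simp
  qed
qed

text \<open>By \<open>cls_image_edge_inj\<close> the collection in \<open>AC\<close> has a single
  member.\<close>

lemma AC_piece:
  assumes "i \<in> {1..n}" "e0 \<in> edges (H i)"
  shows "AC (Some ` cls ` e0) = B i e0"
proof -
  have "j = i \<and> e = e0" if "j \<in> {1..n}" "e \<in> edges (H j)" "Some ` cls ` e0 = Some ` cls ` e" for j e
  proof -
    have "cls ` e0 = cls ` e" using that(3) by (simp add: inj_image_eq_iff)
    then show ?thesis using cls_image_edge_inj[of e0 i e j] assms that(1,2) edges_H by blast
  qed
  note uniq = this
  have "Some ` cls ` e0 \<noteq> {None, Some c}" for c by blast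
  then have "AC (Some ` cls ` e0) = {z. \<exists>j\<in>{1..n}. \<exists>e\<in>edges (H j). Some ` cls ` e0 = Some ` cls ` e \<and> z \<in> B j e}"
    unfolding AC_def by simp
  also have "\<dots> = B i e0"
  proof (rule antisym; rule subsetI)
    fix z assume "z \<in> B i e0"
    then show "z \<in> {z. \<exists>j\<in>{1..n}. \<exists>e\<in>edges (H j). Some ` cls ` e0 = Some ` cls ` e \<and> z \<in> B j e}"
      using assms by (intro CollectI bexI[of _ i] bexI[of _ e0] conjI refl)
  next
    fix z assume "z \<in> {z. \<exists>j\<in>{1..n}. \<exists>e\<in>edges (H j). Some ` cls ` e0 = Some ` cls ` e \<and> z \<in> B j e}"
    then obtain j e where je: "j \<in> {1..n}" "e \<in> edges (H j)" "Some ` cls ` e0 = Some ` cls ` e" "z \<in> B j e"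
      by (elim CollectE bexE conjE)
    then have "j = i \<and> e = e0" by (intro uniq)
    then show "z \<in> B i e0" using je(4) by simp
  qed
  finally show ?thesis .
qed

lemma AC_spoke:
  assumes "i \<in> {1..n}"
  shows "AC {None, Some (cls (u i 2))} = spoke i"
proof -
  have "j = i" if "j \<in> {1..n}" "{None, Some (cls (u i 2))} = {None, Some (cls (u j 2))}" for j
  proof -
    have "cls (u i 2) = cls (u j 2)" using that(2) by (auto simp: doubleton_eq_iff)
    then show ?thesis
      using cls_eq_cases[of "u i 2" "u j 2" i j] u_in(2) assms that(1) u_ne by metis
  qed
  moreover have "Some ` cls ` e0 \<noteq> {None, Some c}" for c e0 by blast
  ultimately show ?thesis unfolding AC_def using assms by blast
qed

lemma AC_meets_KC:
  assumes e: "e \<in> edges C" and x: "x \<in> verts C"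
  shows "AC e \<inter> KC x \<noteq> {} \<longleftrightarrow> x \<in> e"
  using e
proof (cases rule: edges_C_cases)
  case (piece i e0)
  have e0: "e0 \<subseteq> verts (G i)" using piece(1,2) edge_sub edges_H by blast
  show ?thesis
    unfolding piece(3) AC_piece[OF piece(1,2)]
  proof
    assume "B i e0 \<inter> KC x \<noteq> {}"
    then obtain z where z: "z \<in> B i e0" "z \<in> KC x" by blast
    then have zD: "z \<in> D i" using B_D piece(2) by blast
    then have "x \<noteq> None" using z(2) hub_D piece(1) KC_None by metis
    then obtain j v where v: "x = Some (cls v)" using x by (elim verts_C_cases) auto
    from z(2)[unfolded v] obtain w where w: "w \<in> cls v" "w \<in> e0"
    proof (cases rule: KC_Some_cases)
      case (piece j w)
      then have "j = i" using D_disjoint zD P_D \<open>i \<in> {1..n}\<close> by blast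
      then have "w \<in> e0" using B_meets_P[of i e0 w] \<open>i \<in> {1..n}\<close> \<open>e0 \<in> edges (H i)\<close> piece z(1) by blast
      then show ?thesis using that piece by blast
    next
      case (link j)
      \<comment> \<open>A link touches the piece only at a pin, and the pin already belongs to a fat
        vertex of the piece, where incidence is known.\<close>
      from link_D[OF link(3) zD link(1) piece(1)] show ?thesis
      proof
        assume *: "i = j \<and> z = of_real (d j)"
        then have "z \<in> P i (u i 3)" using pins piece(1) by blast
        then have "u i 3 \<in> e0" using B_meets_P[OF piece(1,2) u_in(3)[OF piece(1)]] z(1) by blast
        then show ?thesis using that link(2) * by blast
      next
        assume *: "i = nx j \<and> z = of_real (a i)"
        then have "z \<in> P i (u i 1)" using pins piece(1) by blast
        then have "u i 1 \<in> e0" using B_meets_P[OF piece(1,2) u_in(1)[OF piece(1)]] z(1) by blast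
        moreover have "u i 1 \<in> cls v" using cls_eq[OF link(2)] cls_glue[OF link(1)] cls_self[of "u i 1"] * by simp
        ultimately show ?thesis using that by blast
      qed
    qed
    then show "x \<in> Some ` cls ` e0" using v cls_eq by (metis image_eqI)
  next
    assume "x \<in> Some ` cls ` e0"
    then obtain v where v: "v \<in> e0" "x = Some (cls v)" by blast
    then have "B i e0 \<inter> P i v \<noteq> {}" using B_meets_P piece(1,2) e0 by blast
    then show "B i e0 \<inter> KC x \<noteq> {}" using P_KC[OF piece(1), of v] v e0 by blast
  qed
next
  case (spoke i)
  show ?thesis
    unfolding spoke(2) AC_spoke[OF spoke(1)]
  proof
    assume "spoke i \<inter> KC x \<noteq> {}"
    then obtain z where z: "z \<in> spoke i" "z \<in> KC x" by blast
    show "x \<in> {None, Some (cls (u i 2))}"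
    proof (cases x)
      case (Some c)
      from z(2)[unfolded Some] show ?thesis
      proof (cases rule: KC_Some_cases)
        case (piece j v)
        then have "i = j" "z = of_real (b i)" using spoke_D[OF z(1) _ spoke(1) piece(1)] P_D by blast+
        then have "v = u i 2" using P_inj[of z i v "u i 2"] piece spoke(1) pins u_in(2) by blast
        then have "u i 2 \<in> c" using piece by blast
        moreover obtain w where "c = cls w" using x Some by (elim verts_C_cases) auto
        ultimately show ?thesis using Some cls_eq by blast
      next
        case (link j)
        then show ?thesis using spoke_link z(1) spoke(1) by blast
      qed
    qed simp
  next
    assume "x \<in> {None, Some (cls (u i 2))}"
    then show "spoke i \<inter> KC x \<noteq> {}"
    proof
      assume "x = None"
      then show ?thesis using spoke_ends(2)[OF spoke(1)] KC_None by auto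
    next
      assume "x \<in> {Some (cls (u i 2))}"
      then show ?thesis
        using P_KC[OF spoke(1) u_in(2)[OF spoke(1)]] pins[OF spoke(1)] spoke_ends(1) by blast
    qed
  qed
qed

lemma AC_cross:
  assumes e: "e \<in> edges C" and e': "e' \<in> edges C" and ne: "e \<noteq> e'"
  shows "AC e \<inter> AC e' \<subseteq> \<Union> (KC ` (e \<inter> e'))"
proof -
  \<comment> \<open>A spoke reaches a piece only at the pin of \<open>u i 2\<close>. An edge through
    this pin has \<open>u i 2\<close> as an end, so the crossing point lies in a common fat
    vertex.\<close>
  have mixed: "spoke i \<inter> B j e0 \<subseteq> \<Union> (KC ` ({None, Some (cls (u i 2))} \<inter> Some ` cls ` e0))"
    if i: "i \<in> {1..n}" and j: "j \<in> {1..n}" and e0: "e0 \<in> edges (H j)" for i j e0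
  proof
    fix z assume z: "z \<in> spoke i \<inter> B j e0"
    then have "i = j" "z = of_real (b i)" using spoke_D[of z i j] i j B_D e0 by blast+
    then have zP: "z \<in> P i (u i 2)" using pins i by blast
    then have "u i 2 \<in> e0" using B_meets_P[of i e0 "u i 2"] i e0 \<open>i = j\<close> u_in(2) z by blast
    then have "Some (cls (u i 2)) \<in> {None, Some (cls (u i 2))} \<inter> Some ` cls ` e0" by blast
    moreover have "z \<in> KC (Some (cls (u i 2)))" using zP P_KC[OF i u_in(2)[OF i]] by blast
    ultimately show "z \<in> \<Union> (KC ` ({None, Some (cls (u i 2))} \<inter> Some ` cls ` e0))" by (rule UN_I)
  qed
  show ?thesis
    using e
  proof (cases rule: edges_C_cases)
    case (piece i e0)
    note p1 = this
    from e' show ?thesis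
    proof (cases rule: edges_C_cases)
      case (piece j e1)
      show ?thesis
      proof
        fix z assume "z \<in> AC e \<inter> AC e'"
        then have z: "z \<in> B i e0" "z \<in> B j e1"
          unfolding p1(3) piece(3) AC_piece[OF p1(1,2)] AC_piece[OF piece(1,2)] by auto
        then have ij: "i = j" using D_disjoint B_D p1 piece by blast
        then have "e0 \<noteq> e1" using ne p1(3) piece(3) by blast
        then have "z \<in> \<Union> (P i ` (e0 \<inter> e1))"
          using thick_embeddingD(5)[OF thick[OF p1(1)] p1(2), of e1] piece(2) ij z by blast
        then obtain v where v: "v \<in> e0" "v \<in> e1" "z \<in> P i v" by blast
        have "v \<in> verts (G i)" using v(1) p1(1,2) edge_sub edges_H by blast
        then have "z \<in> KC (Some (cls v))" using P_KC[OF p1(1)] v(3) by blast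
        moreover have "Some (cls v) \<in> e \<inter> e'" using v p1(3) piece(3) by blast
        ultimately show "z \<in> \<Union> (KC ` (e \<inter> e'))" by blast
      qed
    next
      case (spoke j)
      show ?thesis
        using mixed[OF spoke(1) p1(1,2)]
        unfolding p1(3) spoke(2) AC_piece[OF p1(1,2)] AC_spoke[OF spoke(1)] by (simp only: Int_commute)
    qed
  next
    case (spoke i)
    note s1 = this
    from e' show ?thesis
    proof (cases rule: edges_C_cases)
      case (piece j e1)
      show ?thesis
        using mixed[OF s1(1) piece(1,2)]
        unfolding s1(2) piece(3) AC_piece[OF piece(1,2)] AC_spoke[OF s1(1)] .
    next
      case (spoke j)
      then have "i \<noteq> j" using s1(2) ne by blast
      then have "spoke i \<inter> spoke j = {}" using spoke_disjoint s1(1) spoke(1) by blast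
      then show ?thesis unfolding s1(2) spoke(2) AC_spoke[OF s1(1)] AC_spoke[OF spoke(1)] by simp
    qed
  qed
qed

lemma thick_embedding_C: "thick_embedding C KC AC"
  unfolding thick_embedding_def
proof (intro conjI ballI impI)
  fix x y assume "x \<in> verts C" "y \<in> verts C" "x \<noteq> y"
  then show "KC x \<inter> KC y = {}" using KC_disjoint by blast
next
  fix e assume e: "e \<in> edges C"
  then show "path_connected (AC e)"
  proof (cases rule: edges_C_cases)
    case (piece i e0)
    then show ?thesis using thick_embeddingD(3)[OF thick] AC_piece by metis
  next
    case (spoke i)
    then show ?thesis
      unfolding spoke(2) AC_spoke[OF spoke(1)] spoke_def vseg_def by (intro convex_imp_path_connected convex_box)
  qed
  show "AC e \<inter> KC x \<noteq> {} \<longleftrightarrow> x \<in> e" if "x \<in> verts C" for x by (rule AC_meets_KC[OF e that])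
qed (use KC_nonsep AC_cross in auto)

lemma planar_C: "planar C"
  by (rule thick_embedding_imp_planar[OF simple_graph_C thick_embedding_C])

end

theorem theorem2p2:
  fixes k :: nat
    and G :: "nat \<Rightarrow> 'a graph"
    and p :: "nat \<Rightarrow> 'a \<Rightarrow> complex"
    and \<gamma> :: "nat \<Rightarrow> 'a set \<Rightarrow> real \<Rightarrow> complex"
    and u :: "nat \<Rightarrow> nat \<Rightarrow> 'a"
  assumes "k \<ge> 1"
    and "\<And>i. i \<in> {1..2*k+1} \<Longrightarrow> simple_graph (G i)"
    and "\<And>i j. i \<in> {1..2*k+1} \<Longrightarrow> j \<in> {1..2*k+1} \<Longrightarrow> i \<noteq> j \<Longrightarrow> verts (G i) \<inter> verts (G j) = {}"
    and "\<And>i. i \<in> {1..2*k+1} \<Longrightarrow> four_critical (G i)"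
    and "\<And>i. i \<in> {1..2*k+1} \<Longrightarrow> plane_embedding (G i) (p i) (\<gamma> i)"
    and "\<And>i. i \<in> {1..2*k+1} \<Longrightarrow> distinct [u i 1, u i 2, u i 3]"
    and "\<And>i. i \<in> {1..2*k+1} \<Longrightarrow> {u i 1, u i 2} \<in> edges (G i) \<and> {u i 2, u i 3} \<in> edges (G i)"
    and "\<And>i. i \<in> {1..2*k+1} \<Longrightarrow> \<exists>F \<in> faces (G i) (p i) (\<gamma> i).
           path_image (\<gamma> i {u i 1, u i 2}) \<union> path_image (\<gamma> i {u i 2, u i 3}) \<subseteq> frontier F"
  shows "simple_graph (circ_compose (2*k+1) G u) \<and>
         four_critical (circ_compose (2*k+1) G u) \<and>
         planar (circ_compose (2*k+1) G u)"
proof -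
  interpret circ_chain_critical "2*k+1" G u
    using assms(1-4,6,7) by unfold_locales auto
  have "\<exists>K A x1 x2 x3. thick_embedding (H i) K A \<and> x1 < x2 \<and> x2 < x3 \<and>
     complex_of_real x1 \<in> K (u i 1) \<and> complex_of_real x2 \<in> K (u i 2) \<and> complex_of_real x3 \<in> K (u i 3) \<and>
     (\<forall>z \<in> \<Union> (K ` verts (H i)) \<union> \<Union> (A ` edges (H i)). \<bar>Re z\<bar> < 1 \<and> Im z \<le> 0 \<and>
        (Im z = 0 \<longrightarrow> z \<in> {complex_of_real x1, complex_of_real x2, complex_of_real x3}))"
    if i: "i \<in> {1..2*k+1}" for i
  proof -
    obtain F where F: "F \<in> faces (G i) (p i) (\<gamma> i)"
      "path_image (\<gamma> i {u i 1, u i 2}) \<subseteq> frontier F" "path_image (\<gamma> i {u i 2, u i 3}) \<subseteq> frontier F"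
      using assms(8)[OF i] by blast
    show ?thesis
      unfolding H_def
      using thick_embedding_strip[OF assms(2,5,6)[OF i] _ _ F] assms(7)[OF i] by blast
  qed
  then obtain K A x1 x2 x3 where th: "\<And>i. i \<in> {1..2*k+1} \<Longrightarrow> thick_embedding (H i) (K i) (A i)"
    and x: "\<And>i. i \<in> {1..2*k+1} \<Longrightarrow> x1 i < x2 i \<and> x2 i < (x3 i :: real)"
    and pin: "\<And>i. i \<in> {1..2*k+1} \<Longrightarrow> complex_of_real (x1 i) \<in> K i (u i 1) \<and>
      complex_of_real (x2 i) \<in> K i (u i 2) \<and> complex_of_real (x3 i) \<in> K i (u i 3)"
    and str: "\<And>i. i \<in> {1..2*k+1} \<Longrightarrow> \<forall>z \<in> \<Union> (K i ` verts (H i)) \<union> \<Union> (A i ` edges (H i)).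
      \<bar>Re z\<bar> < 1 \<and> Im z \<le> 0 \<and>
        (Im z = 0 \<longrightarrow> z \<in> {complex_of_real (x1 i), complex_of_real (x2 i), complex_of_real (x3 i)})"
    by metis
  \<comment> \<open>The half-strips of half-width 1 are moved to the centres 2, 4, 6, ...;
    neighbours stay disjoint because the bounds are strict.\<close>
  define T where "T i z = z + of_real (2 * real i)" for i :: nat and z :: complex
  have T_real: "T i (of_real x) = of_real (x + 2 * real i)" for i x by (simp add: T_def)
  interpret circ_drawing "2*k+1" G u "\<lambda>i v. T i ` K i v" "\<lambda>i e. T i ` A i e"
    "\<lambda>i. x1 i + 2 * real i" "\<lambda>i. x2 i + 2 * real i" "\<lambda>i. x3 i + 2 * real i"
  proof
    fix i assume i: "i \<in> {1..2*k+1}"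
    show "thick_embedding (H i) (\<lambda>v. T i ` K i v) (\<lambda>e. T i ` A i e)"
    proof (rule thick_embedding_homeomorphic[OF th[OF i], of UNIV])
      show "continuous_on UNIV (T i)" unfolding T_def by (intro continuous_intros)
      show "inj_on (T i) UNIV" by (simp add: T_def inj_on_def)
      show "e \<subseteq> verts (H i)" if "e \<in> edges (H i)" for e
        using that edge_sub[OF i] edges_H by auto
    qed auto
    \<comment> \<open>The pins are points of the drawing, so the bounds of the strip apply to
      them.\<close>
    have V: "u i 1 \<in> verts (H i)" "u i 3 \<in> verts (H i)" using u_in[OF i] by auto
    have "\<bar>x1 i\<bar> < 1" "\<bar>x3 i\<bar> < 1"
      using bspec[OF str[OF i], of "of_real (x1 i)"] bspec[OF str[OF i], of "of_real (x3 i)"] pin[OF i] V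
      by auto
    then show "2 * real i - 1 < x1 i + 2 * real i \<and> x1 i + 2 * real i < x2 i + 2 * real i \<and>
        x2 i + 2 * real i < x3 i + 2 * real i \<and> x3 i + 2 * real i < 2 * real i + 1"
      using x[OF i] by auto
    show "complex_of_real (x1 i + 2 * real i) \<in> T i ` K i (u i 1) \<and>
        complex_of_real (x2 i + 2 * real i) \<in> T i ` K i (u i 2) \<and>
        complex_of_real (x3 i + 2 * real i) \<in> T i ` K i (u i 3)"
      unfolding T_real[symmetric] using pin[OF i] by blast
    fix z assume "z \<in> \<Union> ((\<lambda>v. T i ` K i v) ` verts (H i)) \<union> \<Union> ((\<lambda>e. T i ` A i e) ` edges (H i))"
    then obtain w where w: "w \<in> \<Union> (K i ` verts (H i)) \<union> \<Union> (A i ` edges (H i))" "z = T i w" by blast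
    then show "2 * real i - 1 < Re z \<and> Re z < 2 * real i + 1 \<and> Im z \<le> 0 \<and>
      (Im z = 0 \<longrightarrow> z \<in> {complex_of_real (x1 i + 2 * real i), complex_of_real (x2 i + 2 * real i),
        complex_of_real (x3 i + 2 * real i)})"
      unfolding T_real[symmetric] using bspec[OF str[OF i] w(1)] by (auto simp: T_def)
  qed
  show ?thesis using simple_graph_C four_critical_C planar_C by blast
qed

end
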